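(* For a typical map $f\in\mathcal C[0,1]$, the set $\mathcal O_f$ of pseudo-physical measures is less than topologically meager in the space $\mathcal M_f$ of $f$-invariant measures; that is, $\mathcal O_f$ is a closed subset of $\mathcal M_f$ with empty interior in $\mathcal M_f$.
   Context: $\mathcal C[0,1]$ is the space of continuous maps of $[0,1]$ to itself, with the uniform metric. A property is typical ("holds for a typical map") if there is a dense $G_\delta$ subset $G\subset\mathcal C[0,1]$ such that all $f\in G$ have the property. "Measure" means Borel probability measure on $[0,1]$. Fix a countable dense subset $\{\Psi_i\}_{i\in\mathbb N}$ of $\mathcal C[0,1]$ and let $\mathrm{dist}(\mu,\nu)=\sum_{i\ge1}2^{-i}\left|\int\Psi_i\,d\mu-\int\Psi_i\,d\nu\right|$, which induces the weak$^*$ topology. $\mathcal M_f$ is the set of $f$-invariant measures with this topology. For $x\in[0,1]$, $p\omega(x)$ is the set of weak$^*$ limits of convergent subsequences of $\frac1n\sum_{j=0}^{n-1}\delta_{f^j(x)}$, and $\mathrm{dist}(p\omega(x),\mu)=\inf_{\nu\in p\omega(x)}\mathrm{dist}(\nu,\mu)$. A measure $\mu$ is pseudo-physical for $f$ if for every $\varepsilon>0$ the set $\{x\in[0,1]:\mathrm{dist}(p\omega(x),\mu)<\varepsilon\}$ has positive Lebesgue measure; $\mathcal O_f$ is the set of pseudo-physical measures for $f$ (all of which are $f$-invariant). A subset of a Baire space is called less than topologically meager if it is closed with empty interior. *)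

theory Defs
  imports "HOL-Probability.Probability"
begin

section \<open>Continuous self-maps of the unit interval\<close>

text \<open>Elements of \<^term>\<open>mspace selfmaps\<close> are extensional functions on \<open>{0..1}\<close>
  (equal to \<^term>\<open>undefined\<close> outside), so that the supremum distance separates them.\<close>

definition selfmaps :: "(real \<Rightarrow> real) metric" where
  "selfmaps = cfunspace (top_of_set {0..1}) (submetric euclidean_metric {0..1})"

definition dense_in :: "'a topology \<Rightarrow> 'a set \<Rightarrow> bool" where
  "dense_in X S \<longleftrightarrow> S \<subseteq> topspace X \<and> X closure_of S = topspace X"

definition holds_for_typical_map :: "((real \<Rightarrow> real) \<Rightarrow> bool) \<Rightarrow> bool" where
  "holds_for_typical_map P \<longleftrightarrow>
     (\<exists>G. gdelta_in (mtopology_of selfmaps) G \<and> dense_in (mtopology_of selfmaps) G \<and> (\<forall>f\<in>G. P f))"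

lemma mspace_selfmaps:
  "mspace selfmaps = {f. f \<in> {0..1} \<rightarrow> {0..1} \<and> f \<in> extensional {0..1} \<and> continuous_on {0..1} f}"
  unfolding selfmaps_def
  by (subst compactin_mspace_cfunspace) (auto simp: mtopology_of_submetric)

lemma mdist_selfmaps:
  assumes "f \<in> mspace selfmaps" "g \<in> mspace selfmaps"
  shows "mdist selfmaps f g = (SUP x\<in>{0..1}. \<bar>f x - g x\<bar>)"
proof -
  interpret Metric_space "{0..1::real}" dist
    by (rule Met_TC.subspace) simp
  have "f \<in> fspace {0..1}" "g \<in> fspace {0..1}"
    using assms unfolding selfmaps_def cfunspace_def by auto
  then show ?thesis
    by (simp add: selfmaps_def mdist_cfunspace_eq_mdist_funspace fdist_def dist_real_def)
qed

section \<open>Borel probability measures on the unit interval\<close>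

abbreviation borel01 :: "real measure" where
  "borel01 \<equiv> restrict_space borel {0..1}"

definition probs :: "real measure set" where
  "probs = {\<mu>. prob_space \<mu> \<and> sets \<mu> = sets borel01}"

text \<open>The weak* topology: the coarsest one making \<open>\<mu> \<mapsto> \<integral>\<phi> d\<mu>\<close> continuous for each
  continuous \<open>\<phi>\<close>.\<close>

definition weak_star :: "real measure topology" where
  "weak_star = topology_generated_by
     {{\<mu> \<in> probs. (\<integral>x. \<phi> x \<partial>\<mu>) \<in> U} | (\<phi> :: real \<Rightarrow> real) U. continuous_on {0..1} \<phi> \<and> open U}"

lemma topspace_weak_star [simp]: "topspace weak_star = probs"
proof -
  let ?B = "{{\<mu> \<in> probs. (\<integral>x. \<phi> x \<partial>\<mu>) \<in> U} | (\<phi> :: real \<Rightarrow> real) U.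
    continuous_on {0..1} \<phi> \<and> open U}"
  have "{\<mu> \<in> probs. (\<integral>x. (0::real) \<partial>\<mu>) \<in> UNIV} \<in> ?B"
    by (rule CollectI, rule exI[of _ "\<lambda>x. 0"], rule exI[of _ UNIV]) simp
  then have "probs \<in> ?B"
    by (simp only: UNIV_I simp_thms Collect_mem_eq)
  then have "probs \<subseteq> \<Union> ?B"
    by (rule Union_upper)
  moreover have "\<Union> ?B \<subseteq> probs"
    by (rule Union_least) auto
  ultimately show ?thesis
    unfolding weak_star_def topology_generated_by_topspace by (rule subset_antisym[rotated])
qed

definition invariant_probs :: "(real \<Rightarrow> real) \<Rightarrow> real measure set" where
  "invariant_probs f = {\<mu> \<in> probs. distr \<mu> \<mu> f = \<mu>}"

definition invariant_space :: "(real \<Rightarrow> real) \<Rightarrow> real measure topology" where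
  "invariant_space f = subtopology weak_star (invariant_probs f)"

text \<open>Sequences are indexed from 0 here, so the weights are \<open>1/2, 1/4, \<dots>\<close>.\<close>

definition pdist :: "(nat \<Rightarrow> real \<Rightarrow> real) \<Rightarrow> real measure \<Rightarrow> real measure \<Rightarrow> real" where
  "pdist \<Psi> \<mu> \<nu> = (\<Sum>i. (1/2) ^ Suc i * \<bar>(\<integral>x. \<Psi> i x \<partial>\<mu>) - (\<integral>x. \<Psi> i x \<partial>\<nu>)\<bar>)"

section \<open>Empirical measures and pseudo-physical measures\<close>

definition empirical :: "(real \<Rightarrow> real) \<Rightarrow> real \<Rightarrow> nat \<Rightarrow> real measure" where
  "empirical f x n = measure_of {0..1} (sets borel01)
     (\<lambda>A. (\<Sum>j<n. emeasure (return borel01 ((f ^^ j) x)) A) / of_nat n)"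

lemma sets_empirical [simp]: "sets (empirical f x n) = sets borel01"
  and space_empirical [simp]: "space (empirical f x n) = {0..1}"
proof -
  have "sigma_algebra {0..1} (sets borel01)"
    using sets.sigma_algebra_axioms[of borel01] by (simp add: space_restrict_space)
  then show "sets (empirical f x n) = sets borel01" "space (empirical f x n) = {0..1}"
    using sets.space_closed[of borel01]
    by (simp_all add: empirical_def space_restrict_space space_measure_of sigma_algebra.sigma_sets_eq)
qed

lemma emeasure_empirical:
  assumes "A \<in> sets borel01"
  shows "emeasure (empirical f x n) A =
    (\<Sum>j<n. emeasure (return borel01 ((f ^^ j) x)) A) / of_nat n"
proof (rule emeasure_measure_of[OF empirical_def])
  show "countably_additive (sets (empirical f x n))
     (\<lambda>A. (\<Sum>j<n. emeasure (return borel01 ((f ^^ j) x)) A) / of_nat n)"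
    unfolding countably_additive_def
  proof (intro allI impI)
    fix A :: "nat \<Rightarrow> real set"
    assume A: "range A \<subseteq> sets (empirical f x n)" "disjoint_family A"
    have "(\<Sum>i. \<Sum>j<n. emeasure (return borel01 ((f ^^ j) x)) (A i)) =
        (\<Sum>j<n. \<Sum>i. emeasure (return borel01 ((f ^^ j) x)) (A i))"
      by (rule suminf_sum) auto
    also have "\<dots> = (\<Sum>j<n. emeasure (return borel01 ((f ^^ j) x)) (\<Union> (range A)))"
      using A by (intro sum.cong suminf_emeasure) auto
    finally show "(\<Sum>i. (\<Sum>j<n. emeasure (return borel01 ((f ^^ j) x)) (A i)) / of_nat n) =
        (\<Sum>j<n. emeasure (return borel01 ((f ^^ j) x)) (\<Union> (range A))) / of_nat n"
      by simp
  qed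
qed (use assms in \<open>auto simp: positive_def sets_restrict_space\<close>)

lemma empirical_in_probs:
  assumes f: "f \<in> {0..1} \<rightarrow> {0..1}" and x: "x \<in> {0..1}" and n: "n > 0"
  shows "empirical f x n \<in> probs"
proof -
  have it: "(f ^^ j) x \<in> {0..1}" for j
    by (induction j) (use f x in auto)
  have top: "{0..1::real} \<in> sets borel01"
    using sets.top[of borel01] by (simp add: space_restrict_space)
  have "emeasure (empirical f x n) {0..1} = of_nat n / of_nat n"
    using it top by (simp add: emeasure_empirical del: atLeastAtMost_iff)
  also have "\<dots> = 1"
    using n by (simp add: ennreal_of_nat_eq_real_of_nat divide_ennreal)
  finally show ?thesis
    by (auto simp: probs_def intro!: prob_spaceI)
qed

definition p\<omega> :: "(real \<Rightarrow> real) \<Rightarrow> real \<Rightarrow> real measure set" where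
  "p\<omega> f x = {\<mu>. \<exists>r. strict_mono r \<and> limitin weak_star (\<lambda>k. empirical f x (r k)) \<mu> sequentially}"

definition pseudo_physical :: "(nat \<Rightarrow> real \<Rightarrow> real) \<Rightarrow> (real \<Rightarrow> real) \<Rightarrow> real measure set" where
  "pseudo_physical \<Psi> f =
     {\<mu> \<in> probs. \<forall>\<epsilon>>0. emeasure lebesgue {x \<in> {0..1}. (INF \<nu>\<in>p\<omega> f x. pdist \<Psi> \<nu> \<mu>) < \<epsilon>} > 0}"

definition less_than_meager :: "'a topology \<Rightarrow> 'a set \<Rightarrow> bool" where
  "less_than_meager X S \<longleftrightarrow> closedin X S \<and> X interior_of S = {}"

end

theory Submission
  imports Defs
begin

text \<open>
  A generic map has two disjoint compact intervals that it sends into their own interiors. This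
  property is open, and it is dense because a map can be made constant on two tiny intervals next to
  one of its fixed points (\<open>two_traps_openin\<close>, \<open>two_traps_dense\<close>). The pseudo-physical measures of
  every such map are closed with empty interior.

  Let \<open>K\<close> be one of the two trapping intervals, and let \<open>\<phi>\<close> be a continuous function that is \<open>1\<close> on
  the image of \<open>K\<close> and \<open>0\<close> outside \<open>K\<close>. An orbit either enters \<open>K\<close>, and then never leaves it, or
  avoids \<open>K\<close> forever. The time averages of \<open>\<phi>\<close> therefore converge to \<open>1\<close> or to \<open>0\<close>, so \<open>\<integral>\<phi> d\<nu> \<in> {0, 1}\<close>
  for every \<open>\<nu> \<in> p\<omega> f x\<close>. A pseudo-physical measure is a limit of such \<open>\<nu>\<close>, hence
  has the same property (\<open>trapped_limit_integral\<close>, \<open>pseudo_physical_integral_closed\<close>). On the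
  other hand each trap contains a fixed point, and \<open>\<phi>\<close> takes the values \<open>1\<close> and \<open>0\<close> at these two.
  Given an invariant \<open>\<mu>\<close> with \<open>\<integral>\<phi> d\<mu> \<in> {0, 1}\<close>, move a small mass to the fixed point at which
  \<open>\<phi>\<close> has the other value: the result is an invariant measure arbitrarily close to \<open>\<mu>\<close> whose integral
  lies strictly between \<open>0\<close> and \<open>1\<close>, hence is not pseudo-physical
  (\<open>pseudo_physical_no_interior\<close>).

  Closedness holds for every continuous map. By the triangle inequality a measure within \<open>\<epsilon> / 2\<close> of \<open>\<mu>\<close>
  has its \<open>\<epsilon> / 2\<close>-basin inside the \<open>\<epsilon>\<close>-basin of \<open>\<mu>\<close>, so the measures that fail the definition form
  an open set (\<open>pseudo_physical_closedin\<close>). Two points need care. The infimum over \<open>p\<omega> f x\<close> is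
  meaningful only if that set is nonempty, which is compactness of the space of measures
  (\<open>probs_seq_compact\<close>); and comparing Lebesgue measures of basins requires these to be measurable
  (\<open>p\<omega>_near_measurable\<close>). Invariance of pseudo-physical measures again follows from the behaviour
  of time averages, now those of a coboundary (\<open>pseudo_physical_invariant\<close>).
\<close>

section \<open>Integrating continuous functions against measures on the unit interval\<close>

lemma probs_space: "\<mu> \<in> probs \<Longrightarrow> space \<mu> = {0..1}"
  by (metis (mono_tags, lifting) mem_Collect_eq probs_def sets_eq_imp_space_eq space_restrict_space
      space_borel inf_top.right_neutral)

lemma continuous_measurable_probs:
  fixes \<phi> :: "real \<Rightarrow> 'b::topological_space"
  assumes "\<mu> \<in> probs" "continuous_on {0..1} \<phi>"
  shows "\<phi> \<in> borel_measurable \<mu>"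
proof -
  have "sets \<mu> = sets borel01"
    using assms(1) by (simp add: probs_def)
  moreover have "\<phi> \<in> borel_measurable borel01"
    by (rule borel_measurable_continuous_on_restrict[OF assms(2)])
  ultimately show ?thesis
    by (simp cong: measurable_cong_sets)
qed

lemma continuous_integrable_probs:
  fixes \<phi> :: "real \<Rightarrow> 'b::{banach, second_countable_topology}"
  assumes \<mu>: "\<mu> \<in> probs" and \<phi>: "continuous_on {0..1} \<phi>"
  shows "integrable \<mu> \<phi>"
proof -
  interpret prob_space \<mu> using \<mu> by (simp add: probs_def)
  have "bounded (\<phi> ` {0..1})"
    by (intro compact_imp_bounded compact_continuous_image \<phi>) simp
  then obtain B where "\<And>x. x \<in> {0..1} \<Longrightarrow> norm (\<phi> x) \<le> B"
    unfolding bounded_iff by blast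
  then show ?thesis
    by (intro integrable_const_bound[where B = B] continuous_measurable_probs assms AE_I2)
       (simp add: probs_space[OF \<mu>])
qed

lemma integral_diff_le_probs:
  fixes \<phi> \<psi> :: "real \<Rightarrow> real"
  assumes \<mu>: "\<mu> \<in> probs" and "continuous_on {0..1} \<phi>" "continuous_on {0..1} \<psi>"
    and le: "\<And>x. x \<in> {0..1} \<Longrightarrow> \<bar>\<phi> x - \<psi> x\<bar> \<le> \<eta>"
  shows "\<bar>(\<integral>x. \<phi> x \<partial>\<mu>) - (\<integral>x. \<psi> x \<partial>\<mu>)\<bar> \<le> \<eta>"
proof -
  interpret prob_space \<mu> using \<mu> by (simp add: probs_def)
  note int = continuous_integrable_probs[OF \<mu>]
  have "\<bar>(\<integral>x. \<phi> x \<partial>\<mu>) - (\<integral>x. \<psi> x \<partial>\<mu>)\<bar> = \<bar>\<integral>x. \<phi> x - \<psi> x \<partial>\<mu>\<bar>"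
    by (simp only: Bochner_Integration.integral_diff[OF int[OF assms(2)] int[OF assms(3)]])
  also have "\<dots> \<le> (\<integral>x. \<bar>\<phi> x - \<psi> x\<bar> \<partial>\<mu>)"
    by (rule integral_abs_bound)
  also have "\<dots> \<le> (\<integral>x. \<eta> \<partial>\<mu>)"
    using le by (intro integral_mono int continuous_intros assms) (auto simp: probs_space[OF \<mu>])
  finally show ?thesis by (simp add: prob_space)
qed

lemma integral_in_01:
  fixes \<phi> :: "real \<Rightarrow> real"
  assumes \<mu>: "\<mu> \<in> probs" and \<phi>: "continuous_on {0..1} \<phi>" "\<phi> \<in> {0..1} \<rightarrow> {0..1}"
  shows "(\<integral>x. \<phi> x \<partial>\<mu>) \<in> {0..1}"
proof -
  interpret prob_space \<mu> using \<mu> by (simp add: probs_def)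
  have "(\<integral>x. \<phi> x \<partial>\<mu>) \<ge> 0"
    using \<phi>(2) by (intro integral_nonneg_AE AE_I2) (auto simp: probs_space[OF \<mu>])
  moreover have "(\<integral>x. \<phi> x \<partial>\<mu>) \<le> (\<integral>x. 1 \<partial>\<mu>)"
    using \<phi> continuous_integrable_probs[OF \<mu>] by (intro integral_mono) (auto simp: probs_space[OF \<mu>])
  ultimately show ?thesis by (simp add: prob_space)
qed

lemma id_measurable_probs: "\<mu> \<in> probs \<Longrightarrow> (\<lambda>x. x) \<in> measurable \<mu> borel"
  by (rule continuous_measurable_probs) auto

lemma probs_eq_if_borel_extensions_eq:
  assumes "\<mu> \<in> probs" "\<nu> \<in> probs" and eq: "distr \<mu> borel (\<lambda>x. x) = distr \<nu> borel (\<lambda>x. x)"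
  shows "\<mu> = \<nu>"
proof (rule measure_eqI)
  show "sets \<mu> = sets \<nu>" using assms by (simp add: probs_def)
  fix A assume "A \<in> sets \<mu>"
  then have A: "A \<in> sets borel" "A \<subseteq> {0..1}"
    using assms(1) by (auto simp: probs_def sets_restrict_space)
  have "emeasure \<rho> A = emeasure (distr \<rho> borel (\<lambda>x. x)) A" if "\<rho> \<in> probs" for \<rho>
    using A that by (auto simp: emeasure_distr id_measurable_probs probs_space Int_absorb2)
  then show "emeasure \<mu> A = emeasure \<nu> A" using assms by simp
qed

text \<open>The real and imaginary parts of the characteristic function are integrals of continuous
  functions, so these integrals determine the measure by Levy's uniqueness theorem. Rescaling
  to values in the unit interval is harmless.\<close>

lemma probs_eqI:
  assumes \<mu>: "\<mu> \<in> probs" and \<nu>: "\<nu> \<in> probs"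
    and eq: "\<And>\<phi> :: real \<Rightarrow> real. continuous_on {0..1} \<phi> \<Longrightarrow> \<phi> \<in> {0..1} \<rightarrow> {0..1} \<Longrightarrow>
               (\<integral>x. \<phi> x \<partial>\<mu>) = (\<integral>x. \<phi> x \<partial>\<nu>)"
  shows "\<mu> = \<nu>"
proof (rule probs_eq_if_borel_extensions_eq[OF \<mu> \<nu>])
  interpret M: prob_space \<mu> using \<mu> by (simp add: probs_def)
  interpret N: prob_space \<nu> using \<nu> by (simp add: probs_def)
  note [measurable] = id_measurable_probs[OF \<mu>] id_measurable_probs[OF \<nu>]
  have trig: "(\<integral>x. h x \<partial>\<mu>) = (\<integral>x. h x \<partial>\<nu>)"
    if h: "continuous_on {0..1} h" "\<And>x. \<bar>h x\<bar> \<le> 1" for h :: "real \<Rightarrow> real"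
  proof -
    have "(\<integral>x. (1 + h x) / 2 \<partial>\<mu>) = (\<integral>x. (1 + h x) / 2 \<partial>\<nu>)"
    proof (rule eq)
      show "(\<lambda>x. (1 + h x) / 2) \<in> {0..1} \<rightarrow> {0..1}"
        using h(2) by (auto simp: abs_le_iff) (smt (verit))
    qed (intro continuous_intros h; simp)
    moreover have "(\<integral>x. (1 + h x) / 2 \<partial>\<mu>) = (1 + (\<integral>x. h x \<partial>\<mu>)) / 2"
      using continuous_integrable_probs[OF \<mu> h(1)] by (simp add: M.prob_space)
    moreover have "(\<integral>x. (1 + h x) / 2 \<partial>\<nu>) = (1 + (\<integral>x. h x \<partial>\<nu>)) / 2"
      using continuous_integrable_probs[OF \<nu> h(1)] by (simp add: N.prob_space)
    ultimately show ?thesis by simp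
  qed
  have ch: "char (distr \<rho> borel (\<lambda>x. x)) t = Complex (\<integral>x. cos (t * x) \<partial>\<rho>) (\<integral>x. sin (t * x) \<partial>\<rho>)"
    if \<rho>: "\<rho> \<in> probs" for \<rho> t
  proof -
    have int: "integrable \<rho> (\<lambda>x. iexp (t * x))"
      by (intro continuous_integrable_probs[OF \<rho>] continuous_intros)
    have "char (distr \<rho> borel (\<lambda>x. x)) t = (\<integral>x. iexp (t * x) \<partial>\<rho>)"
      unfolding char_def using id_measurable_probs[OF \<rho>]
      by (subst integral_distr) auto
    also have "\<dots> = Complex (\<integral>x. Re (iexp (t * x)) \<partial>\<rho>) (\<integral>x. Im (iexp (t * x)) \<partial>\<rho>)"
      using int by (simp only: complex_eq_iff complex.sel integral_Re integral_Im simp_thms)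
    finally show ?thesis by (simp add: Re_exp Im_exp)
  qed
  show "distr \<mu> borel (\<lambda>x. x) = distr \<nu> borel (\<lambda>x. x)"
  proof (rule Levy_uniqueness)
    show "char (distr \<mu> borel (\<lambda>x. x)) = char (distr \<nu> borel (\<lambda>x. x))"
      by (rule ext) (simp add: ch \<mu> \<nu> trig continuous_intros)
  qed simp_all
qed

lemma selfmap_measurable:
  assumes \<mu>: "\<mu> \<in> probs" and f: "f \<in> mspace selfmaps"
  shows "f \<in> measurable \<mu> \<mu>"
proof -
  have f': "continuous_on {0..1} f" "f \<in> {0..1} \<rightarrow> {0..1}"
    using f by (auto simp: mspace_selfmaps)
  have "f \<in> measurable \<mu> borel01"
    using continuous_measurable_probs[OF \<mu> f'(1)] f'(2)
    by (auto simp: measurable_restrict_space2_iff probs_space[OF \<mu>])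
  moreover have "sets \<mu> = sets borel01" using \<mu> by (simp add: probs_def)
  ultimately show ?thesis by (simp cong: measurable_cong_sets)
qed

lemma invariant_probsI:
  assumes \<mu>: "\<mu> \<in> probs" and f: "f \<in> mspace selfmaps"
    and eq: "\<And>\<phi> :: real \<Rightarrow> real. continuous_on {0..1} \<phi> \<Longrightarrow> \<phi> \<in> {0..1} \<rightarrow> {0..1} \<Longrightarrow>
               (\<integral>x. \<phi> (f x) \<partial>\<mu>) = (\<integral>x. \<phi> x \<partial>\<mu>)"
  shows "\<mu> \<in> invariant_probs f"
proof -
  interpret prob_space \<mu> using \<mu> by (simp add: probs_def)
  note m = selfmap_measurable[OF \<mu> f]
  have p: "distr \<mu> \<mu> f \<in> probs"
    using \<mu> m by (simp add: probs_def prob_space_distr)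
  have "distr \<mu> \<mu> f = \<mu>"
  proof (rule probs_eqI[OF p \<mu>])
    fix \<phi> :: "real \<Rightarrow> real"
    assume \<phi>: "continuous_on {0..1} \<phi>" "\<phi> \<in> {0..1} \<rightarrow> {0..1}"
    show "(\<integral>x. \<phi> x \<partial>distr \<mu> \<mu> f) = (\<integral>x. \<phi> x \<partial>\<mu>)"
      using eq[OF \<phi>] integral_distr[OF m continuous_measurable_probs[OF \<mu> \<phi>(1)]] by simp
  qed
  with \<mu> show ?thesis by (simp add: invariant_probs_def)
qed

lemma invariant_integral:
  fixes \<phi> :: "real \<Rightarrow> real"
  assumes \<mu>: "\<mu> \<in> invariant_probs f" and f: "f \<in> mspace selfmaps" and \<phi>: "continuous_on {0..1} \<phi>"
  shows "(\<integral>x. \<phi> (f x) \<partial>\<mu>) = (\<integral>x. \<phi> x \<partial>\<mu>)"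
proof -
  have \<mu>': "\<mu> \<in> probs" "distr \<mu> \<mu> f = \<mu>" using \<mu> by (auto simp: invariant_probs_def)
  show ?thesis
    using integral_distr[OF selfmap_measurable[OF \<mu>'(1) f] continuous_measurable_probs[OF \<mu>'(1) \<phi>]]
      \<mu>'(2) by simp
qed

section \<open>The weak* topology\<close>

lemma openin_weak_star_basis:
  fixes \<phi> :: "real \<Rightarrow> real"
  assumes "continuous_on {0..1} \<phi>" "open U"
  shows "openin weak_star {\<mu> \<in> probs. (\<integral>x. \<phi> x \<partial>\<mu>) \<in> U}"
  unfolding weak_star_def by (rule topology_generated_by_Basis) (use assms in blast)

text \<open>It suffices to test convergence on the generating sets of the topology, by induction on how an
  open set is generated from them.\<close>

lemma limitin_weak_star_iff:
  "limitin weak_star \<sigma> \<mu> sequentially \<longleftrightarrow>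
     \<mu> \<in> probs \<and> (\<forall>\<^sub>F k in sequentially. \<sigma> k \<in> probs) \<and>
     (\<forall>\<phi> :: real \<Rightarrow> real. continuous_on {0..1} \<phi> \<longrightarrow>
        (\<lambda>k. \<integral>x. \<phi> x \<partial>\<sigma> k) \<longlonglongrightarrow> (\<integral>x. \<phi> x \<partial>\<mu>))"
  (is "?L \<longleftrightarrow> ?R")
proof
  assume L: ?L
  have \<mu>: "\<mu> \<in> probs" using limitin_topspace[OF L] by simp
  have ev: "\<forall>\<^sub>F k in sequentially. \<sigma> k \<in> U" if "openin weak_star U" "\<mu> \<in> U" for U
    using L that by (auto simp: limitin_def)
  have "\<forall>\<^sub>F k in sequentially. \<sigma> k \<in> probs"
    using ev[of probs] \<mu> openin_topspace[of weak_star] by simp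
  moreover have "(\<lambda>k. \<integral>x. \<phi> x \<partial>\<sigma> k) \<longlonglongrightarrow> (\<integral>x. \<phi> x \<partial>\<mu>)"
    if "continuous_on {0..1} \<phi>" for \<phi> :: "real \<Rightarrow> real"
  proof (rule topological_tendstoI)
    fix S :: "real set" assume S: "open S" "(\<integral>x. \<phi> x \<partial>\<mu>) \<in> S"
    show "\<forall>\<^sub>F k in sequentially. (\<integral>x. \<phi> x \<partial>\<sigma> k) \<in> S"
      by (rule eventually_mono[OF ev[OF openin_weak_star_basis[OF that S(1)]]]) (use \<mu> S in auto)
  qed
  ultimately show ?R using \<mu> by blast
next
  assume R: ?R
  have "\<forall>\<^sub>F k in sequentially. \<sigma> k \<in> U" if "openin weak_star U" "\<mu> \<in> U" for U
    using openin_topology_generated_by[OF that(1)[unfolded weak_star_def]] that(2)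
  proof induction
    case (Basis s)
    then obtain \<phi> :: "real \<Rightarrow> real" and U where s: "s = {\<mu> \<in> probs. (\<integral>x. \<phi> x \<partial>\<mu>) \<in> U}"
      and \<phi>: "continuous_on {0..1} \<phi>" and U: "open U" by blast
    then have "\<forall>\<^sub>F k in sequentially. (\<integral>x. \<phi> x \<partial>\<sigma> k) \<in> U"
      using R Basis(2) by (auto intro!: topological_tendstoD[where l = "\<integral>x. \<phi> x \<partial>\<mu>"])
    with R show ?case
      unfolding s by (auto elim: eventually_elim2)
  next
    case (UN K)
    from \<open>\<mu> \<in> \<Union>K\<close> obtain V where "V \<in> K" "\<mu> \<in> V" by blast
    then show ?case by (intro eventually_mono[OF UN.IH]) auto
  qed (auto intro: eventually_conj)
  with R show ?L by (auto simp: limitin_def)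
qed

text \<open>Extending the measures to the line, sequential compactness becomes Helly's selection
  theorem, since measures on a bounded interval are tight. Retracting the line onto the interval
  brings the limit back, and it extends the test functions to bounded continuous functions on
  the line.\<close>

lemma probs_seq_compact:
  fixes \<sigma> :: "nat \<Rightarrow> real measure"
  assumes \<sigma>: "\<And>k. \<sigma> k \<in> probs"
  obtains r \<mu> where "strict_mono r" "\<mu> \<in> probs" "limitin weak_star (\<lambda>k. \<sigma> (r k)) \<mu> sequentially"
proof -
  define \<tau> where "\<tau> k = distr (\<sigma> k) borel (\<lambda>x. x)" for k
  define clamp :: "real \<Rightarrow> real" where "clamp x = max 0 (min 1 x)" for x
  have clamp: "continuous_on S clamp" "clamp x \<in> {0..1}" "x \<in> {0..1} \<Longrightarrow> clamp x = x" for S x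
    unfolding clamp_def by (auto intro!: continuous_intros)
  have \<tau>: "real_distribution (\<tau> k)" for k
    unfolding \<tau>_def using \<sigma>[of k] id_measurable_probs[OF \<sigma>, of k]
    by (intro prob_space.real_distribution_distr) (auto simp: probs_def)
  have "tight \<tau>"
    unfolding tight_def
  proof (intro conjI allI impI \<tau>)
    fix \<epsilon> :: real assume \<epsilon>: "0 < \<epsilon>"
    have "measure (\<tau> n) {-1<..1} = 1" for n
    proof -
      interpret prob_space "\<sigma> n" using \<sigma>[of n] by (simp add: probs_def)
      have "measure (\<tau> n) {-1<..1} = measure (\<sigma> n) ((\<lambda>x. x) -` {-1<..1} \<inter> space (\<sigma> n))"
        unfolding \<tau>_def using id_measurable_probs[OF \<sigma>[of n]] by (intro measure_distr) auto
      also have "(\<lambda>x. x) -` {-1<..1} \<inter> space (\<sigma> n) = space (\<sigma> n)"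
        using probs_space[OF \<sigma>[of n]] by auto
      finally show ?thesis by (simp add: prob_space)
    qed
    then show "\<exists>a b. a < b \<and> (\<forall>n. 1 - \<epsilon> < measure (\<tau> n) {a<..b})"
      using \<epsilon> by (intro exI[of _ "-1"] exI[of _ 1]) auto
  qed
  from tight_imp_convergent_subsubsequence[OF this strict_mono_id]
  obtain r M where r: "strict_mono r" and M: "real_distribution M"
    and conv: "weak_conv_m (\<tau> \<circ> r) M" by (auto simp: o_def id_def)
  interpret M: real_distribution M by fact
  define \<mu> where "\<mu> = distr M borel01 clamp"
  have clamp_m: "clamp \<in> measurable M borel01"
    using clamp(1)[of UNIV] clamp(2)
    by (auto simp: measurable_restrict_space2_iff borel_measurable_continuous_onI)
  have \<mu>: "\<mu> \<in> probs"
    unfolding \<mu>_def probs_def using M.prob_space_distr[OF clamp_m] by simp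
  have "(\<lambda>k. \<integral>x. \<phi> x \<partial>\<sigma> (r k)) \<longlonglongrightarrow> (\<integral>x. \<phi> x \<partial>\<mu>)"
    if \<phi>: "continuous_on {0..1} \<phi>" for \<phi> :: "real \<Rightarrow> real"
  proof -
    have "bounded (\<phi> ` {0..1})"
      by (intro compact_imp_bounded compact_continuous_image \<phi>) simp
    then obtain B where B: "\<And>x. x \<in> {0..1} \<Longrightarrow> norm (\<phi> x) \<le> B"
      unfolding bounded_iff by blast
    have c: "continuous_on UNIV (\<lambda>x. \<phi> (clamp x))"
      by (rule continuous_on_compose2[OF \<phi> clamp(1)]) (use clamp(2) in blast)
    have "(\<lambda>k. \<integral>x. \<phi> (clamp x) \<partial>(\<tau> \<circ> r) k) \<longlonglongrightarrow> (\<integral>x. \<phi> (clamp x) \<partial>M)"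
    proof (rule weak_conv_imp_integral_bdd_continuous_conv[OF _ M conv])
      show "isCont (\<lambda>x. \<phi> (clamp x)) x" for x
        using c by (simp add: continuous_on_eq_continuous_at)
      show "norm (\<phi> (clamp x)) \<le> B" for x using B clamp(2) by blast
    qed (simp add: \<tau>)
    moreover have "(\<integral>x. \<phi> (clamp x) \<partial>(\<tau> \<circ> r) k) = (\<integral>x. \<phi> x \<partial>\<sigma> (r k))" for k
    proof -
      have "(\<integral>x. \<phi> (clamp x) \<partial>(\<tau> \<circ> r) k) = (\<integral>x. \<phi> (clamp x) \<partial>\<sigma> (r k))"
        unfolding \<tau>_def o_def
        by (rule integral_distr[OF id_measurable_probs[OF \<sigma>]])
           (use c in \<open>simp add: borel_measurable_continuous_onI\<close>)
      also have "\<dots> = (\<integral>x. \<phi> x \<partial>\<sigma> (r k))"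
        by (rule Bochner_Integration.integral_cong) (auto simp: clamp(3) probs_space[OF \<sigma>])
      finally show ?thesis .
    qed
    moreover have "(\<integral>x. \<phi> (clamp x) \<partial>M) = (\<integral>x. \<phi> x \<partial>\<mu>)"
      unfolding \<mu>_def
      by (rule integral_distr[symmetric, OF clamp_m borel_measurable_continuous_on_restrict[OF \<phi>]])
    ultimately show ?thesis by simp
  qed
  then have "limitin weak_star (\<lambda>k. \<sigma> (r k)) \<mu> sequentially"
    using \<mu> \<sigma> by (simp add: limitin_weak_star_iff)
  with r \<mu> that show thesis by blast
qed

section \<open>The distance of measures\<close>

text \<open>These conditions make the series in \<^const>\<open>pdist\<close> converge and turn it into a weak* continuous
  pseudometric on \<^const>\<open>probs\<close>.\<close>

definition test_functions :: "(nat \<Rightarrow> real \<Rightarrow> real) \<Rightarrow> bool" where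
  "test_functions \<Psi> \<longleftrightarrow> (\<forall>i. continuous_on {0..1} (\<Psi> i) \<and> \<Psi> i \<in> {0..1} \<rightarrow> {0..1})"

lemma pdist_term_le:
  assumes "test_functions \<Psi>" "\<mu> \<in> probs" "\<nu> \<in> probs"
  shows "\<bar>(\<integral>x. \<Psi> i x \<partial>\<mu>) - (\<integral>x. \<Psi> i x \<partial>\<nu>)\<bar> \<le> 1"
  using integral_in_01[of \<mu> "\<Psi> i"] integral_in_01[of \<nu> "\<Psi> i"] assms
  by (auto simp: test_functions_def abs_le_iff)

lemma pdist_summable:
  assumes "test_functions \<Psi>" "\<mu> \<in> probs" "\<nu> \<in> probs"
  shows "summable (\<lambda>i. (1/2) ^ Suc i * \<bar>(\<integral>x. \<Psi> i x \<partial>\<mu>) - (\<integral>x. \<Psi> i x \<partial>\<nu>)\<bar>)"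
proof (rule summable_comparison_test'[of "\<lambda>i. (1/2 :: real) ^ i * (1/2)" 0])
  show "summable (\<lambda>i. (1/2 :: real) ^ i * (1/2))"
    by (intro summable_mult2 summable_geometric) simp
  show "norm ((1/2) ^ Suc i * \<bar>(\<integral>x. \<Psi> i x \<partial>\<mu>) - (\<integral>x. \<Psi> i x \<partial>\<nu>)\<bar>) \<le> (1/2) ^ i * (1/2)" for i
    using mult_left_mono[OF pdist_term_le[OF assms, of i], of "(1/2)^i * (1/2)"]
    by (simp add: abs_mult)
qed

lemma pdist_nonneg:
  assumes "test_functions \<Psi>" "\<mu> \<in> probs" "\<nu> \<in> probs"
  shows "0 \<le> pdist \<Psi> \<mu> \<nu>"
  unfolding pdist_def by (intro suminf_nonneg pdist_summable assms) simp

lemma pdist_commute: "pdist \<Psi> \<mu> \<nu> = pdist \<Psi> \<nu> \<mu>"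
  unfolding pdist_def by (simp add: abs_minus_commute)

lemma pdist_triangle:
  assumes "test_functions \<Psi>" "\<mu> \<in> probs" "\<nu> \<in> probs" "\<rho> \<in> probs"
  shows "pdist \<Psi> \<mu> \<rho> \<le> pdist \<Psi> \<mu> \<nu> + pdist \<Psi> \<nu> \<rho>"
proof -
  define w where "w = (\<lambda>\<mu> \<nu> i. (1/2 :: real) ^ Suc i * \<bar>(\<integral>x. \<Psi> i x \<partial>\<mu>) - (\<integral>x. \<Psi> i x \<partial>\<nu>)\<bar>)"
  have S: "summable (w \<mu> \<nu>)" "summable (w \<nu> \<rho>)" "summable (w \<mu> \<rho>)"
    unfolding w_def by (intro pdist_summable assms)+
  have "w \<mu> \<rho> i \<le> w \<mu> \<nu> i + w \<nu> \<rho> i" for i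
    unfolding w_def distrib_left[symmetric] by (intro mult_left_mono) auto
  then have "(\<Sum>i. w \<mu> \<rho> i) \<le> (\<Sum>i. w \<mu> \<nu> i + w \<nu> \<rho> i)"
    by (intro suminf_le S summable_add)
  also have "\<dots> = (\<Sum>i. w \<mu> \<nu> i) + (\<Sum>i. w \<nu> \<rho> i)"
    using suminf_add[OF S(1,2)] by simp
  finally show ?thesis by (simp add: pdist_def w_def)
qed

text \<open>Since each coordinate contributes at most its weight, finitely many test functions determine
  the distance up to an arbitrarily small tail.\<close>

lemma pdist_less_openin:
  assumes \<Psi>: "test_functions \<Psi>" and \<mu>: "\<mu> \<in> probs" and \<epsilon>: "0 < \<epsilon>"
  obtains W where "openin weak_star W" "\<mu> \<in> W" "\<And>\<nu>. \<nu> \<in> W \<Longrightarrow> pdist \<Psi> \<nu> \<mu> < \<epsilon>"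
proof -
  obtain N where N: "(1/2 :: real) ^ N < \<epsilon> / 2"
    using real_arch_pow_inv[of "\<epsilon>/2" "1/2"] \<epsilon> by auto
  define B where "B i = {\<nu> \<in> probs. (\<integral>x. \<Psi> i x \<partial>\<nu>) \<in> ball (\<integral>x. \<Psi> i x \<partial>\<mu>) (\<epsilon> / 2)}" for i
  define W where "W = probs \<inter> (\<Inter>i\<in>{..<N}. B i)"
  have "openin weak_star (B i)" for i
    unfolding B_def using \<Psi> by (intro openin_weak_star_basis) (auto simp: test_functions_def)
  then have "openin weak_star W"
    unfolding W_def using openin_topspace[of weak_star] topspace_weak_star
    by (cases "N = 0") (auto intro!: openin_Int openin_Inter simp: simp del: openin_topspace)
  moreover have "\<mu> \<in> W" using \<mu> \<epsilon> by (simp add: W_def B_def)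
  moreover have "pdist \<Psi> \<nu> \<mu> < \<epsilon>" if "\<nu> \<in> W" for \<nu>
  proof -
    have \<nu>: "\<nu> \<in> probs" using that by (simp add: W_def)
    define a where "a i = \<bar>(\<integral>x. \<Psi> i x \<partial>\<nu>) - (\<integral>x. \<Psi> i x \<partial>\<mu>)\<bar>" for i
    have a1: "a i \<le> 1" for i unfolding a_def by (rule pdist_term_le[OF \<Psi> \<nu> \<mu>])
    have a2: "a i \<le> \<epsilon> / 2" if "i < N" for i
      using \<open>\<nu> \<in> W\<close> that by (auto simp: W_def B_def a_def dist_real_def abs_minus_commute intro: less_imp_le)
    have geo: "(\<lambda>i. (1/2 :: real) ^ Suc i) sums 1" by (rule power_half_series)
    note S = pdist_summable[OF \<Psi> \<nu> \<mu>, folded a_def]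
    have "pdist \<Psi> \<nu> \<mu> = (\<Sum>i. (1/2) ^ Suc (i + N) * a (i + N)) + (\<Sum>i<N. (1/2) ^ Suc i * a i)"
      unfolding pdist_def a_def[symmetric] by (rule suminf_split_initial_segment[OF S])
    also have "(\<Sum>i. (1/2) ^ Suc (i + N) * a (i + N)) \<le> (\<Sum>i. (1/2) ^ Suc i * (1/2) ^ N)"
    proof (rule suminf_le)
      show "(1/2) ^ Suc (i + N) * a (i + N) \<le> (1/2) ^ Suc i * (1/2) ^ N" for i
        using mult_left_mono[OF a1, of "(1/2) ^ Suc (i + N)" "i + N"] by (simp add: power_add)
      show "summable (\<lambda>i. (1/2) ^ Suc (i + N) * a (i + N))"
        using S by (subst summable_iff_shift)
      show "summable (\<lambda>i. (1/2 :: real) ^ Suc i * (1/2) ^ N)"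
        by (intro summable_mult2 sums_summable[OF geo])
    qed
    also have "(\<Sum>i. (1/2 :: real) ^ Suc i * (1/2) ^ N) = (1/2) ^ N"
      using suminf_mult2[OF sums_summable[OF geo], of "(1/2) ^ N"] sums_unique[OF geo] by simp
    also have "(\<Sum>i<N. (1/2) ^ Suc i * a i) \<le> (\<Sum>i<N. (1/2) ^ Suc i * (\<epsilon> / 2))"
      by (intro sum_mono mult_left_mono a2) auto
    also have "\<dots> = (\<Sum>i<N. (1/2) ^ Suc i) * (\<epsilon> / 2)"
      by (rule sum_distrib_right[symmetric])
    also have "\<dots> \<le> 1 * (\<epsilon> / 2)"
      using \<epsilon> sum_le_suminf[OF sums_summable[OF geo], of "{..<N}"] sums_unique[OF geo]
      by (intro mult_right_mono) auto
    finally show ?thesis using N by simp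
  qed
  ultimately show thesis by (rule that)
qed

lemma pdist_tendsto:
  assumes \<Psi>: "test_functions \<Psi>" and \<mu>: "\<mu> \<in> probs"
    and lim: "limitin weak_star \<sigma> \<nu> sequentially"
  shows "(\<lambda>k. pdist \<Psi> (\<sigma> k) \<mu>) \<longlonglongrightarrow> pdist \<Psi> \<nu> \<mu>"
proof (rule tendstoI)
  fix \<epsilon> :: real assume "0 < \<epsilon>"
  have \<nu>: "\<nu> \<in> probs" and ev: "\<forall>\<^sub>F k in sequentially. \<sigma> k \<in> probs"
    using lim by (auto simp: limitin_weak_star_iff)
  obtain W where W: "openin weak_star W" "\<nu> \<in> W" "\<And>\<rho>. \<rho> \<in> W \<Longrightarrow> pdist \<Psi> \<rho> \<nu> < \<epsilon>"
    using pdist_less_openin[OF \<Psi> \<nu> \<open>0 < \<epsilon>\<close>] by blast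
  have "\<forall>\<^sub>F k in sequentially. \<sigma> k \<in> W" using lim W by (auto simp: limitin_def)
  with ev show "\<forall>\<^sub>F k in sequentially. dist (pdist \<Psi> (\<sigma> k) \<mu>) (pdist \<Psi> \<nu> \<mu>) < \<epsilon>"
  proof eventually_elim
    case (elim k)
    have "pdist \<Psi> (\<sigma> k) \<nu> < \<epsilon>" using W(3) elim(2) .
    then show ?case
      using pdist_triangle[OF \<Psi> elim(1) \<nu> \<mu>] pdist_triangle[OF \<Psi> \<nu> elim(1) \<mu>]
        pdist_commute[of \<Psi> \<nu> "\<sigma> k"]
      by (simp add: dist_real_def)
  qed
qed

lemma dense_test_functions:
  assumes "dense_in (mtopology_of selfmaps) (range \<Psi>)"
  shows "test_functions \<Psi>"
  using assms unfolding dense_in_def test_functions_def by (auto simp: mspace_selfmaps image_subset_iff)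

lemma selfmaps_diff_le_mdist:
  assumes f: "f \<in> mspace selfmaps" and g: "g \<in> mspace selfmaps" and x: "x \<in> {0..1}"
  shows "\<bar>f x - g x\<bar> \<le> mdist selfmaps f g"
proof -
  have "\<bar>f y - g y\<bar> \<le> 1" if "y \<in> {0..1}" for y
  proof -
    have "f y \<in> {0..1}" "g y \<in> {0..1}"
      using f g Pi_mem[OF _ that] by (auto simp only: mspace_selfmaps)
    then show ?thesis by auto
  qed
  then have "bdd_above ((\<lambda>y. \<bar>f y - g y\<bar>) ` {0..1})"
    by (auto intro!: bdd_aboveI2[where M = 1])
  then show ?thesis
    unfolding mdist_selfmaps[OF f g] by (rule cSUP_upper[OF x])
qed

text \<open>A single coordinate \<open>\<Psi> i\<close> close to \<open>\<phi>\<close> already controls the integral of \<open>\<phi>\<close>.\<close>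

lemma pdist_controls_integral:
  fixes \<phi> :: "real \<Rightarrow> real"
  assumes dense: "dense_in (mtopology_of selfmaps) (range \<Psi>)"
    and \<phi>: "continuous_on {0..1} \<phi>" "\<phi> \<in> {0..1} \<rightarrow> {0..1}" and \<eta>: "0 < \<eta>"
  obtains \<delta> where "0 < \<delta>"
    "\<And>\<mu> \<nu>. \<mu> \<in> probs \<Longrightarrow> \<nu> \<in> probs \<Longrightarrow> pdist \<Psi> \<mu> \<nu> < \<delta> \<Longrightarrow>
       \<bar>(\<integral>x. \<phi> x \<partial>\<mu>) - (\<integral>x. \<phi> x \<partial>\<nu>)\<bar> < \<eta>"
proof -
  note \<Psi> = dense_test_functions[OF dense]
  interpret S: Metric_space "mspace selfmaps" "mdist selfmaps"
    by (rule Metric_space_mspace_mdist)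
  define g where "g = restrict \<phi> {0..1}"
  have g: "g \<in> mspace selfmaps"
    using \<phi>(2) continuous_on_eq[OF \<phi>(1), of g] by (auto simp: mspace_selfmaps g_def)
  then have "g \<in> S.mtopology closure_of (range \<Psi>)"
    using dense by (auto simp: dense_in_def mtopology_of_def)
  then obtain i where i: "\<Psi> i \<in> mspace selfmaps" "mdist selfmaps g (\<Psi> i) < \<eta> / 4"
    using \<eta> by (auto simp: S.metric_closure_of dest!: spec[of _ "\<eta> / 4"])
  have near: "\<bar>\<phi> x - \<Psi> i x\<bar> \<le> \<eta> / 4" if x: "x \<in> {0..1}" for x
    using selfmaps_diff_le_mdist[OF g i(1) x] i(2) x by (simp add: g_def)
  show thesis
  proof (rule that[of "(1/2) ^ Suc i * (\<eta> / 4)"])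
    show "0 < (1/2) ^ Suc i * (\<eta> / 4)" using \<eta> by simp
    fix \<mu> \<nu> assume \<mu>: "\<mu> \<in> probs" and \<nu>: "\<nu> \<in> probs" and d: "pdist \<Psi> \<mu> \<nu> < (1/2) ^ Suc i * (\<eta> / 4)"
    let ?w = "\<lambda>i. (1/2 :: real) ^ Suc i * \<bar>(\<integral>x. \<Psi> i x \<partial>\<mu>) - (\<integral>x. \<Psi> i x \<partial>\<nu>)\<bar>"
    have "?w i = sum ?w {i}" by simp
    also have "\<dots> \<le> pdist \<Psi> \<mu> \<nu>"
      unfolding pdist_def by (intro sum_le_suminf pdist_summable \<Psi> \<mu> \<nu>) auto
    also note d
    finally have "\<bar>(\<integral>x. \<Psi> i x \<partial>\<mu>) - (\<integral>x. \<Psi> i x \<partial>\<nu>)\<bar> < \<eta> / 4"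
      by (subst (asm) mult_less_cancel_left_pos) simp_all
    moreover have "\<bar>(\<integral>x. \<phi> x \<partial>\<rho>) - (\<integral>x. \<Psi> i x \<partial>\<rho>)\<bar> \<le> \<eta> / 4" if "\<rho> \<in> probs" for \<rho>
      using \<Psi> by (intro integral_diff_le_probs that \<phi> near) (auto simp: test_functions_def)
    from this[OF \<mu>] this[OF \<nu>]
    have "\<bar>(\<integral>x. \<phi> x \<partial>\<mu>) - (\<integral>x. \<Psi> i x \<partial>\<mu>)\<bar> \<le> \<eta> / 4" "\<bar>(\<integral>x. \<phi> x \<partial>\<nu>) - (\<integral>x. \<Psi> i x \<partial>\<nu>)\<bar> \<le> \<eta> / 4" .
    ultimately show "\<bar>(\<integral>x. \<phi> x \<partial>\<mu>) - (\<integral>x. \<phi> x \<partial>\<nu>)\<bar> < \<eta>" using \<eta> by linarith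
  qed
qed

section \<open>Empirical measures and their limits\<close>

lemma orbit_in_01:
  assumes "f \<in> mspace selfmaps" "x \<in> {0..1}"
  shows "(f ^^ j) x \<in> {0..1}"
  using assms by (induction j) (auto simp: mspace_selfmaps Pi_iff)

lemma orbit_continuous:
  assumes f: "f \<in> mspace selfmaps"
  shows "continuous_on {0..1} (\<lambda>x. (f ^^ j) x)"
proof (induction j)
  case (Suc j)
  have "continuous_on {0..1} (\<lambda>x. f ((f ^^ j) x))"
    by (rule continuous_on_compose2[OF _ Suc]) (use f orbit_in_01[OF f] in \<open>auto simp: mspace_selfmaps\<close>)
  then show ?case by simp
qed (simp add: continuous_on_id)

text \<open>An empirical measure is the image of the uniform distribution on the times \<open>0, \<dots>, n - 1\<close>.\<close>

lemma integral_empirical: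
  fixes \<phi> :: "real \<Rightarrow> real"
  assumes f: "f \<in> mspace selfmaps" and x: "x \<in> {0..1}" and n: "0 < n" and \<phi>: "continuous_on {0..1} \<phi>"
  shows "(\<integral>y. \<phi> y \<partial>empirical f x n) = (\<Sum>j<n. \<phi> ((f ^^ j) x)) / n"
proof -
  let ?p = "measure_pmf (pmf_of_set {..<n})"
  have m: "(\<lambda>j. (f ^^ j) x) \<in> measurable ?p borel01"
    using orbit_in_01[OF f x] by (simp add: space_restrict_space)
  have ne: "{..<n} \<noteq> {}" using n by auto
  have "empirical f x n = distr ?p borel01 (\<lambda>j. (f ^^ j) x)"
  proof (rule measure_eqI)
    fix A assume "A \<in> sets (empirical f x n)"
    then have A: "A \<in> sets borel01" by simp
    have "emeasure (distr ?p borel01 (\<lambda>j. (f ^^ j) x)) A = emeasure ?p ((\<lambda>j. (f ^^ j) x) -` A)"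
      using emeasure_distr[OF m A] by simp
    also have "\<dots> = ennreal (card ({..<n} \<inter> (\<lambda>j. (f ^^ j) x) -` A) / card {..<n})"
      by (rule emeasure_pmf_of_set[OF ne]) simp
    also have "\<dots> = of_nat (card ({..<n} \<inter> (\<lambda>j. (f ^^ j) x) -` A)) / of_nat n"
      using n by (simp add: divide_ennreal ennreal_of_nat_eq_real_of_nat)
    also have "of_nat (card ({..<n} \<inter> (\<lambda>j. (f ^^ j) x) -` A)) =
        (\<Sum>j<n. emeasure (return borel01 ((f ^^ j) x)) A)"
      using A by (simp add: indicator_def sum.If_cases vimage_def Int_def)
    finally show "emeasure (empirical f x n) A = emeasure (distr ?p borel01 (\<lambda>j. (f ^^ j) x)) A"
      by (simp add: emeasure_empirical[OF A])
  qed simp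
  then have "(\<integral>y. \<phi> y \<partial>empirical f x n) = (\<integral>j. \<phi> ((f ^^ j) x) \<partial>?p)"
    using integral_distr[OF m borel_measurable_continuous_on_restrict[OF \<phi>]] by simp
  also have "\<dots> = (\<Sum>j<n. \<phi> ((f ^^ j) x)) / n"
    using integral_pmf_of_set[OF ne] by simp
  finally show ?thesis .
qed

lemma empirical_probs:
  "f \<in> mspace selfmaps \<Longrightarrow> x \<in> {0..1} \<Longrightarrow> 0 < n \<Longrightarrow> empirical f x n \<in> probs"
  by (rule empirical_in_probs) (auto simp: mspace_selfmaps)

lemma p\<omega>_probs: "\<nu> \<in> p\<omega> f x \<Longrightarrow> \<nu> \<in> probs"
  by (auto simp: p\<omega>_def limitin_weak_star_iff)

lemma empirical_subsequence_limit:
  assumes f: "f \<in> mspace selfmaps" and x: "x \<in> {0..1}" and s: "strict_mono (s :: nat \<Rightarrow> nat)"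
  obtains r \<nu> where "strict_mono r" "\<nu> \<in> p\<omega> f x"
    "limitin weak_star (\<lambda>k. empirical f x (s (r k))) \<nu> sequentially"
proof -
  \<comment> \<open>The shift by one avoids time \<open>0\<close>, for which the empirical measure is not a probability.\<close>
  have "empirical f x (s (Suc k)) \<in> probs" for k
    using seq_suble[OF s, of "Suc k"] by (intro empirical_probs f x) simp
  then obtain r \<nu> where r: "strict_mono r"
    and lim: "limitin weak_star (\<lambda>k. empirical f x (s (Suc (r k)))) \<nu> sequentially"
    using probs_seq_compact[of "\<lambda>k. empirical f x (s (Suc k))"] by blast
  have r': "strict_mono (\<lambda>k. Suc (r k))" using r by (simp add: strict_mono_def)
  moreover have "strict_mono (\<lambda>k. s (Suc (r k)))"
    using r' s by (simp add: strict_mono_def)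
  with lim have "\<nu> \<in> p\<omega> f x" unfolding p\<omega>_def by blast
  ultimately show thesis using lim by (rule that)
qed

lemma p\<omega>_nonempty:
  assumes "f \<in> mspace selfmaps" "x \<in> {0..1}"
  shows "p\<omega> f x \<noteq> {}"
  using empirical_subsequence_limit[OF assms strict_mono_id] by blast

lemma p\<omega>_integral:
  fixes \<phi> :: "real \<Rightarrow> real"
  assumes f: "f \<in> mspace selfmaps" and x: "x \<in> {0..1}" and \<nu>: "\<nu> \<in> p\<omega> f x"
    and \<phi>: "continuous_on {0..1} \<phi>"
    and L: "(\<lambda>n. (\<Sum>j<n. \<phi> ((f ^^ j) x)) / n) \<longlonglongrightarrow> L"
  shows "(\<integral>y. \<phi> y \<partial>\<nu>) = L"
proof -
  obtain r where r: "strict_mono r" and lim: "limitin weak_star (\<lambda>k. empirical f x (r k)) \<nu> sequentially"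
    using \<nu> by (auto simp: p\<omega>_def)
  have "(\<lambda>k. (\<Sum>j<r k. \<phi> ((f ^^ j) x)) / r k) \<longlonglongrightarrow> L"
    using LIMSEQ_subseq_LIMSEQ[OF L r] by (simp add: o_def)
  moreover have "\<forall>\<^sub>F k in sequentially. (\<Sum>j<r k. \<phi> ((f ^^ j) x)) / r k = (\<integral>y. \<phi> y \<partial>empirical f x (r k))"
    using eventually_gt_at_top[of 0]
  proof eventually_elim
    case (elim k)
    then show ?case
      using seq_suble[OF r, of k] by (intro integral_empirical[symmetric] f x \<phi>) simp
  qed
  ultimately have "(\<lambda>k. \<integral>y. \<phi> y \<partial>empirical f x (r k)) \<longlonglongrightarrow> L"
    by (rule Lim_transform_eventually)
  moreover have "(\<lambda>k. \<integral>y. \<phi> y \<partial>empirical f x (r k)) \<longlonglongrightarrow> (\<integral>y. \<phi> y \<partial>\<nu>)"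
    using lim \<phi> by (auto simp: limitin_weak_star_iff)
  ultimately show ?thesis by (rule LIMSEQ_unique[rotated])
qed

lemma INF_p\<omega>_less_iff:
  assumes f: "f \<in> mspace selfmaps" and x: "x \<in> {0..1}" and \<Psi>: "test_functions \<Psi>" and \<mu>: "\<mu> \<in> probs"
  shows "(INF \<nu>\<in>p\<omega> f x. pdist \<Psi> \<nu> \<mu>) < \<epsilon> \<longleftrightarrow> (\<exists>\<nu>\<in>p\<omega> f x. pdist \<Psi> \<nu> \<mu> < \<epsilon>)"
proof -
  have "bdd_below ((\<lambda>\<nu>. pdist \<Psi> \<nu> \<mu>) ` p\<omega> f x)"
    by (rule bdd_belowI2[where m = 0]) (intro pdist_nonneg \<Psi> \<mu> p\<omega>_probs)
  then show ?thesis by (rule cInf_less_iff[OF _ , of "_ ` _", simplified, OF p\<omega>_nonempty[OF f x]])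
qed

text \<open>By compactness the distance of \<open>\<mu>\<close> to \<^term>\<open>p\<omega> f x\<close> is the lower limit of its distances to
  the empirical measures, which depend measurably on \<open>x\<close>. The sets in the definition of
  \<^const>\<open>pseudo_physical\<close> are therefore measurable; this matters because \<^const>\<open>emeasure\<close> assigns \<open>0\<close>
  to nonmeasurable sets, however large.\<close>

lemma p\<omega>_near_iff:
  assumes f: "f \<in> mspace selfmaps" and x: "x \<in> {0..1}" and \<Psi>: "test_functions \<Psi>" and \<mu>: "\<mu> \<in> probs"
  shows "(\<exists>\<nu>\<in>p\<omega> f x. pdist \<Psi> \<nu> \<mu> < \<epsilon>) \<longleftrightarrow>
    (\<exists>q\<in>\<rat>. q < \<epsilon> \<and> (\<exists>\<^sub>\<infinity>n. pdist \<Psi> (empirical f x n) \<mu> < q))"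
proof
  assume "\<exists>\<nu>\<in>p\<omega> f x. pdist \<Psi> \<nu> \<mu> < \<epsilon>"
  then obtain \<nu> where \<nu>: "\<nu> \<in> p\<omega> f x" "pdist \<Psi> \<nu> \<mu> < \<epsilon>" by blast
  obtain q where q: "q \<in> \<rat>" "pdist \<Psi> \<nu> \<mu> < q" "q < \<epsilon>" using Rats_dense_in_real[OF \<nu>(2)] by blast
  obtain r where r: "strict_mono r" and lim: "limitin weak_star (\<lambda>k. empirical f x (r k)) \<nu> sequentially"
    using \<nu> by (auto simp: p\<omega>_def)
  have "\<forall>\<^sub>F k in sequentially. pdist \<Psi> (empirical f x (r k)) \<mu> < q"
    using order_tendstoD(2)[OF pdist_tendsto[OF \<Psi> \<mu> lim] q(2)] .
  then obtain K where K: "\<And>k. k \<ge> K \<Longrightarrow> pdist \<Psi> (empirical f x (r k)) \<mu> < q"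
    by (auto simp: eventually_sequentially)
  have "\<exists>\<^sub>\<infinity>n. pdist \<Psi> (empirical f x n) \<mu> < q"
    unfolding INFM_nat_le
  proof
    fix m
    show "\<exists>n\<ge>m. pdist \<Psi> (empirical f x n) \<mu> < q"
      using K[of "max m K"] seq_suble[OF r, of "max m K"] by (intro exI[of _ "r (max m K)"]) auto
  qed
  with q show "\<exists>q\<in>\<rat>. q < \<epsilon> \<and> (\<exists>\<^sub>\<infinity>n. pdist \<Psi> (empirical f x n) \<mu> < q)" by blast
next
  assume "\<exists>q\<in>\<rat>. q < \<epsilon> \<and> (\<exists>\<^sub>\<infinity>n. pdist \<Psi> (empirical f x n) \<mu> < q)"
  then obtain q where q: "q < \<epsilon>" and inf: "infinite {n. pdist \<Psi> (empirical f x n) \<mu> < q}"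
    by (auto simp: INFM_iff_infinite)
  define s where "s = enumerate {n. pdist \<Psi> (empirical f x n) \<mu> < q}"
  have s: "strict_mono s" "\<And>k. pdist \<Psi> (empirical f x (s k)) \<mu> < q"
    unfolding s_def using enumerate_in_set[OF inf] strict_mono_enumerate[OF inf] by auto
  obtain r \<nu> where \<nu>: "\<nu> \<in> p\<omega> f x"
    and lim: "limitin weak_star (\<lambda>k. empirical f x (s (r k))) \<nu> sequentially"
    using empirical_subsequence_limit[OF f x s(1)] by blast
  have "pdist \<Psi> \<nu> \<mu> \<le> q"
    by (rule LIMSEQ_le_const2[OF pdist_tendsto[OF \<Psi> \<mu> lim]]) (use s(2) less_imp_le in blast)
  with \<nu> q show "\<exists>\<nu>\<in>p\<omega> f x. pdist \<Psi> \<nu> \<mu> < \<epsilon>" by force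
qed

lemma pdist_empirical_measurable:
  assumes f: "f \<in> mspace selfmaps" and \<Psi>: "test_functions \<Psi>" and n: "0 < n"
  shows "(\<lambda>x. pdist \<Psi> (empirical f x n) \<mu>) \<in> borel_measurable borel01"
proof -
  have "(\<lambda>x. \<Sum>i. (1/2) ^ Suc i * \<bar>(\<Sum>j<n. \<Psi> i ((f ^^ j) x)) / n - (\<integral>x. \<Psi> i x \<partial>\<mu>)\<bar>)
      \<in> borel_measurable borel01"
  proof (intro borel_measurable_suminf borel_measurable_continuous_on_restrict)
    fix i
    have "continuous_on {0..1} (\<lambda>x. \<Psi> i ((f ^^ j) x))" for j
      by (rule continuous_on_compose2[OF _ orbit_continuous[OF f]])
         (use \<Psi> orbit_in_01[OF f] in \<open>auto simp: test_functions_def\<close>)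
    then show "continuous_on {0..1}
        (\<lambda>x. (1/2) ^ Suc i * \<bar>(\<Sum>j<n. \<Psi> i ((f ^^ j) x)) / n - (\<integral>x. \<Psi> i x \<partial>\<mu>)\<bar>)"
      using n by (intro continuous_intros) auto
  qed
  moreover have "pdist \<Psi> (empirical f x n) \<mu> =
      (\<Sum>i. (1/2) ^ Suc i * \<bar>(\<Sum>j<n. \<Psi> i ((f ^^ j) x)) / n - (\<integral>x. \<Psi> i x \<partial>\<mu>)\<bar>)"
    if "x \<in> space borel01" for x
    unfolding pdist_def using that \<Psi> n
    by (subst integral_empirical[OF f]) (auto simp: space_restrict_space test_functions_def)
  ultimately show ?thesis by (subst measurable_cong)
qed

lemma p\<omega>_near_measurable:
  assumes f: "f \<in> mspace selfmaps" and \<Psi>: "test_functions \<Psi>" and \<mu>: "\<mu> \<in> probs"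
  shows "{x \<in> {0..1}. (INF \<nu>\<in>p\<omega> f x. pdist \<Psi> \<nu> \<mu>) < \<epsilon>} \<in> sets lebesgue"
proof -
  have "{x \<in> space borel01. pdist \<Psi> (empirical f x (Suc n)) \<mu> < q} \<in> sets borel01" for n q
    using pdist_empirical_measurable[OF f \<Psi>, of "Suc n"] by measurable
  then have b: "{x \<in> {0..1}. pdist \<Psi> (empirical f x (Suc n)) \<mu> < q} \<in> sets borel" for n q
    using sets_restrict_space_iff[of "{0..1::real}" borel] by (simp add: space_restrict_space del: atLeastAtMost_iff)
  have "{x \<in> {0..1}. (INF \<nu>\<in>p\<omega> f x. pdist \<Psi> \<nu> \<mu>) < \<epsilon>} =
      (\<Union>q\<in>{q\<in>\<rat>. q < \<epsilon>}. \<Inter>m. \<Union>n\<in>{m..}. {x \<in> {0..1}. pdist \<Psi> (empirical f x (Suc n)) \<mu> < q})"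
  proof -
    have shift: "(\<exists>\<^sub>\<infinity>n. P n) \<longleftrightarrow> (\<forall>m. \<exists>n\<ge>m. P (Suc n))" for P :: "nat \<Rightarrow> bool"
    proof -
      have "(\<exists>\<^sub>\<infinity>n. P n) \<longleftrightarrow> (\<exists>\<^sub>\<infinity>n. P (Suc n))"
        by (simp add: frequently_def cofinite_eq_sequentially
            eventually_sequentially_Suc[of "\<lambda>n. \<not> P n"])
      then show ?thesis by (simp add: INFM_nat_le)
    qed
    have iff: "(INF \<nu>\<in>p\<omega> f x. pdist \<Psi> \<nu> \<mu>) < \<epsilon> \<longleftrightarrow>
        (\<exists>q\<in>{q\<in>\<rat>. q < \<epsilon>}. \<forall>m. \<exists>n\<in>{m..}. pdist \<Psi> (empirical f x (Suc n)) \<mu> < q)"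
      if x: "x \<in> {0..1}" for x
      unfolding INF_p\<omega>_less_iff[OF f x \<Psi> \<mu>] p\<omega>_near_iff[OF f x \<Psi> \<mu>] shift
      by (simp only: Bex_def mem_Collect_eq atLeast_iff conj_assoc)
    show ?thesis
      unfolding set_eq_iff UN_iff INT_iff mem_Collect_eq using iff by blast
  qed
  also have "\<dots> \<in> sets borel"
    by (intro sets.countable_UN'' sets.countable_INT'' b)
       (auto intro: countable_subset[OF _ countable_rat])
  finally show ?thesis by simp
qed

section \<open>Pseudo-physical measures\<close>

lemma pseudo_physical_probs: "pseudo_physical \<Psi> f \<subseteq> probs"
  unfolding pseudo_physical_def by (rule Collect_restrict)

lemma pseudo_physical_near:
  assumes f: "f \<in> mspace selfmaps" and \<Psi>: "test_functions \<Psi>"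
    and \<mu>: "\<mu> \<in> pseudo_physical \<Psi> f" and \<epsilon>: "0 < \<epsilon>"
  obtains x \<nu> where "x \<in> {0..1}" "\<nu> \<in> p\<omega> f x" "pdist \<Psi> \<nu> \<mu> < \<epsilon>"
proof -
  have "\<mu> \<in> probs" and "emeasure lebesgue {x \<in> {0..1}. (INF \<nu>\<in>p\<omega> f x. pdist \<Psi> \<nu> \<mu>) < \<epsilon>} > 0"
    using \<mu> \<epsilon> by (auto simp: pseudo_physical_def)
  then have "\<mu> \<in> probs" and "{x \<in> {0..1}. (INF \<nu>\<in>p\<omega> f x. pdist \<Psi> \<nu> \<mu>) < \<epsilon>} \<noteq> {}"
    by (simp, metis (lifting) emeasure_empty less_irrefl)
  then show thesis
    using that INF_p\<omega>_less_iff[OF f _ \<Psi> \<open>\<mu> \<in> probs\<close>] by blast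
qed

text \<open>This transfers information about the limit measures of orbits to pseudo-physical measures,
  which they approximate.\<close>

lemma pseudo_physical_integral_closed:
  fixes \<phi> :: "real \<Rightarrow> real"
  assumes dense: "dense_in (mtopology_of selfmaps) (range \<Psi>)" and f: "f \<in> mspace selfmaps"
    and \<phi>: "continuous_on {0..1} \<phi>" "\<phi> \<in> {0..1} \<rightarrow> {0..1}" and C: "closed C"
    and lim: "\<And>x \<nu>. x \<in> {0..1} \<Longrightarrow> \<nu> \<in> p\<omega> f x \<Longrightarrow> (\<integral>y. \<phi> y \<partial>\<nu>) \<in> C"
    and \<mu>: "\<mu> \<in> pseudo_physical \<Psi> f"
  shows "(\<integral>y. \<phi> y \<partial>\<mu>) \<in> C"
proof -
  have "\<exists>c\<in>C. dist c (\<integral>y. \<phi> y \<partial>\<mu>) < \<eta>" if \<eta>: "0 < \<eta>" for \<eta>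
  proof -
    obtain \<delta> where \<delta>: "0 < \<delta>" "\<And>\<mu> \<nu>. \<mu> \<in> probs \<Longrightarrow> \<nu> \<in> probs \<Longrightarrow> pdist \<Psi> \<mu> \<nu> < \<delta> \<Longrightarrow>
       \<bar>(\<integral>x. \<phi> x \<partial>\<mu>) - (\<integral>x. \<phi> x \<partial>\<nu>)\<bar> < \<eta>"
      using pdist_controls_integral[OF dense \<phi> \<eta>] by blast
    obtain x \<nu> where x: "x \<in> {0..1}" "\<nu> \<in> p\<omega> f x" "pdist \<Psi> \<nu> \<mu> < \<delta>"
      using pseudo_physical_near[OF f dense_test_functions[OF dense] \<mu> \<delta>(1)] by blast
    then show ?thesis
      using \<delta>(2)[of \<nu> \<mu>] lim[OF x(1,2)] \<mu> p\<omega>_probs[OF x(2)]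
      by (auto simp: dist_real_def pseudo_physical_def)
  qed
  then show ?thesis using C closed_approachable by blast
qed

lemma pseudo_physical_invariant:
  assumes dense: "dense_in (mtopology_of selfmaps) (range \<Psi>)" and f: "f \<in> mspace selfmaps"
  shows "pseudo_physical \<Psi> f \<subseteq> invariant_probs f"
proof
  fix \<mu> assume \<mu>: "\<mu> \<in> pseudo_physical \<Psi> f"
  then have \<mu>p: "\<mu> \<in> probs" by (simp add: pseudo_physical_def)
  interpret prob_space \<mu> using \<mu>p by (simp add: probs_def)
  show "\<mu> \<in> invariant_probs f"
  proof (rule invariant_probsI[OF \<mu>p f])
    fix \<phi> :: "real \<Rightarrow> real"
    assume \<phi>: "continuous_on {0..1} \<phi>" "\<phi> \<in> {0..1} \<rightarrow> {0..1}"
    \<comment> \<open>A rescaling of the coboundary of \<open>\<phi>\<close>, whose Birkhoff averages telescope.\<close>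
    define h where "h x = (1 + (\<phi> (f x) - \<phi> x)) / 2" for x
    have f': "continuous_on {0..1} f" "f \<in> {0..1} \<rightarrow> {0..1}"
      using f by (auto simp: mspace_selfmaps)
    have \<phi>f: "continuous_on {0..1} (\<lambda>x. \<phi> (f x))"
      by (rule continuous_on_compose2[OF \<phi>(1) f'(1)]) (use f'(2) in auto)
    have bd: "\<phi> x \<in> {0..1}" "\<phi> (f x) \<in> {0..1}" if "x \<in> {0..1}" for x
      using Pi_mem[OF \<phi>(2)] Pi_mem[OF f'(2)] that by blast+
    have h: "continuous_on {0..1} h" "h \<in> {0..1} \<rightarrow> {0..1}"
    proof -
      show "continuous_on {0..1} h"
        unfolding h_def by (intro continuous_intros \<phi> \<phi>f) simp
      show "h \<in> {0..1} \<rightarrow> {0..1}"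
      proof
        fix x :: real assume "x \<in> {0..1}"
        then show "h x \<in> {0..1}" using bd[of x] by (simp add: h_def)
      qed
    qed
    have "(\<integral>y. h y \<partial>\<nu>) \<in> {1/2}" if x: "x \<in> {0..1}" and \<nu>: "\<nu> \<in> p\<omega> f x" for x \<nu>
    proof -
      have "(\<Sum>j<n. h ((f ^^ j) x)) / n = 1/2 + (\<phi> ((f ^^ n) x) - \<phi> x) / 2 / n" if "0 < n" for n
      proof -
        have "(\<Sum>j<n. h ((f ^^ j) x)) = (n + (\<Sum>j<n. \<phi> ((f ^^ Suc j) x) - \<phi> ((f ^^ j) x))) / 2"
          by (simp add: h_def sum.distrib flip: sum_divide_distrib)
        also have "\<dots> = (n + (\<phi> ((f ^^ n) x) - \<phi> x)) / 2"
          by (subst sum_lessThan_telescope) simp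
        finally show ?thesis using that by (simp add: field_simps)
      qed
      then have ev: "\<forall>\<^sub>F n in sequentially. 1/2 + (\<phi> ((f ^^ n) x) - \<phi> x) / 2 / n = (\<Sum>j<n. h ((f ^^ j) x)) / n"
        by (intro eventually_mono[OF eventually_gt_at_top[of 0]]) simp
      have "(\<lambda>n. (\<phi> ((f ^^ n) x) - \<phi> x) / 2 / n) \<longlonglongrightarrow> 0"
      proof (rule Lim_null_comparison)
        show "\<forall>\<^sub>F n in sequentially. norm ((\<phi> ((f ^^ n) x) - \<phi> x) / 2 / n) \<le> 1 / real n"
        proof (rule always_eventually, rule allI)
          fix n
          have "\<bar>\<phi> ((f ^^ n) x) - \<phi> x\<bar> \<le> 1"
            using bd(1)[OF x] bd(1)[OF orbit_in_01[OF f x, of n]] by auto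
          then have "\<bar>\<phi> ((f ^^ n) x) - \<phi> x\<bar> / 2 / n \<le> 1 / real n"
            by (intro divide_right_mono) auto
          then show "norm ((\<phi> ((f ^^ n) x) - \<phi> x) / 2 / n) \<le> 1 / real n"
            by (simp add: abs_divide)
        qed
      qed (rule lim_1_over_n)
      then have "(\<lambda>n. 1/2 + (\<phi> ((f ^^ n) x) - \<phi> x) / 2 / n) \<longlonglongrightarrow> 1/2 + 0"
        by (intro tendsto_intros)
      then have "(\<lambda>n. (\<Sum>j<n. h ((f ^^ j) x)) / n) \<longlonglongrightarrow> 1/2"
        using Lim_transform_eventually[OF _ ev] by simp
      then show ?thesis using p\<omega>_integral[OF f x \<nu> h(1)] by simp
    qed
    from pseudo_physical_integral_closed[OF dense f h _ this \<mu>]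
    have "(\<integral>y. h y \<partial>\<mu>) = 1/2" by simp
    moreover have "(\<integral>y. h y \<partial>\<mu>) = (1 + ((\<integral>x. \<phi> (f x) \<partial>\<mu>) - (\<integral>x. \<phi> x \<partial>\<mu>))) / 2"
      unfolding h_def using continuous_integrable_probs[OF \<mu>p \<phi>(1)] continuous_integrable_probs[OF \<mu>p \<phi>f]
      by (simp add: prob_space)
    ultimately show "(\<integral>x. \<phi> (f x) \<partial>\<mu>) = (\<integral>x. \<phi> x \<partial>\<mu>)" by simp
  qed
qed

text \<open>Moving \<open>\<mu>\<close> by \<open>\<epsilon> / 2\<close> and shrinking the radius from \<open>\<epsilon>\<close> to \<open>\<epsilon> / 2\<close> yields a smaller basin, so
  a null basin of \<open>\<mu>\<close> forces null basins of all nearby measures.\<close>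

lemma pseudo_physical_closedin:
  assumes f: "f \<in> mspace selfmaps" and \<Psi>: "test_functions \<Psi>"
  shows "closedin weak_star (pseudo_physical \<Psi> f)"
proof -
  have "openin weak_star (probs - pseudo_physical \<Psi> f)"
  proof (subst openin_subopen, intro ballI)
    fix \<mu> assume "\<mu> \<in> probs - pseudo_physical \<Psi> f"
    then obtain \<epsilon> where \<mu>: "\<mu> \<in> probs" and \<epsilon>: "0 < \<epsilon>"
      and null: "\<not> emeasure lebesgue {x \<in> {0..1}. (INF \<nu>\<in>p\<omega> f x. pdist \<Psi> \<nu> \<mu>) < \<epsilon>} > 0"
      by (auto simp: pseudo_physical_def)
    obtain W where W: "openin weak_star W" "\<mu> \<in> W" "\<And>\<nu>. \<nu> \<in> W \<Longrightarrow> pdist \<Psi> \<nu> \<mu> < \<epsilon> / 2"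
      using pdist_less_openin[OF \<Psi> \<mu>, of "\<epsilon> / 2"] \<epsilon> by auto
    have Wp: "W \<subseteq> probs" using openin_subset[OF W(1)] by simp
    have "\<rho> \<notin> pseudo_physical \<Psi> f" if "\<rho> \<in> W" for \<rho>
    proof
      assume "\<rho> \<in> pseudo_physical \<Psi> f"
      then have \<rho>: "\<rho> \<in> probs" and "\<forall>\<epsilon>>0. emeasure lebesgue {x \<in> {0..1}. (INF \<nu>\<in>p\<omega> f x. pdist \<Psi> \<nu> \<rho>) < \<epsilon>} > 0"
        unfolding pseudo_physical_def by blast+
      then have pos: "emeasure lebesgue {x \<in> {0..1}. (INF \<nu>\<in>p\<omega> f x. pdist \<Psi> \<nu> \<rho>) < \<epsilon> / 2} > 0"
        using \<epsilon> by (metis half_gt_zero)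
      have "{x \<in> {0..1}. (INF \<nu>\<in>p\<omega> f x. pdist \<Psi> \<nu> \<rho>) < \<epsilon> / 2} \<subseteq>
          {x \<in> {0..1}. (INF \<nu>\<in>p\<omega> f x. pdist \<Psi> \<nu> \<mu>) < \<epsilon>}"
      proof safe
        fix x assume x: "x \<in> {0..1::real}" "(INF \<nu>\<in>p\<omega> f x. pdist \<Psi> \<nu> \<rho>) < \<epsilon> / 2"
        then obtain \<nu> where \<nu>: "\<nu> \<in> p\<omega> f x" "pdist \<Psi> \<nu> \<rho> < \<epsilon> / 2"
          using INF_p\<omega>_less_iff[OF f x(1) \<Psi> \<rho>] by blast
        then have "pdist \<Psi> \<nu> \<mu> < \<epsilon>"
          using pdist_triangle[OF \<Psi> p\<omega>_probs[OF \<nu>(1)] \<rho> \<mu>] W(3)[OF that] by simp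
        with \<nu> show "(INF \<nu>\<in>p\<omega> f x. pdist \<Psi> \<nu> \<mu>) < \<epsilon>"
          using INF_p\<omega>_less_iff[OF f x(1) \<Psi> \<mu>] by blast
      qed
      from emeasure_mono[OF this p\<omega>_near_measurable[OF f \<Psi> \<mu>]] pos null show False by order
    qed
    with W(1,2) Wp show "\<exists>T. openin weak_star T \<and> \<mu> \<in> T \<and> T \<subseteq> probs - pseudo_physical \<Psi> f" by blast
  qed
  then show ?thesis by (simp add: closedin_def pseudo_physical_probs)
qed

section \<open>Mixing an invariant measure with a point mass\<close>

lemma mix_point_mass:
  assumes \<mu>: "\<mu> \<in> probs" and p: "p \<in> {0..1}" and t: "0 \<le> t" "t \<le> 1"
  obtains \<rho> where "\<rho> \<in> probs"
    "\<And>\<phi> :: real \<Rightarrow> real. continuous_on {0..1} \<phi> \<Longrightarrow>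
       (\<integral>x. \<phi> x \<partial>\<rho>) = (1 - t) * (\<integral>x. \<phi> x \<partial>\<mu>) + t * \<phi> p"
proof -
  \<comment> \<open>Toss a coin to decide between \<open>p\<close> and a point drawn from \<open>\<mu>\<close>.\<close>
  let ?B = "measure_pmf (bernoulli_pmf t)"
  let ?g = "\<lambda>(x, b). if b then p else x"
  interpret M: prob_space \<mu> using \<mu> by (simp add: probs_def)
  interpret P: pair_prob_space \<mu> ?B ..
  have [measurable_cong]: "sets \<mu> = sets borel01" using \<mu> by (simp add: probs_def)
  have [measurable]: "p \<in> space borel01" using p by (simp add: space_restrict_space)
  have g: "?g \<in> measurable (\<mu> \<Otimes>\<^sub>M ?B) borel01" by measurable
  show thesis
  proof (rule that[of "distr (\<mu> \<Otimes>\<^sub>M ?B) borel01 ?g"])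
    show "distr (\<mu> \<Otimes>\<^sub>M ?B) borel01 ?g \<in> probs"
      unfolding probs_def using P.prob_space_distr[OF g] by simp
    fix \<phi> :: "real \<Rightarrow> real" assume \<phi>: "continuous_on {0..1} \<phi>"
    have \<phi>m: "\<phi> \<in> borel_measurable borel01"
      by (rule borel_measurable_continuous_on_restrict[OF \<phi>])
    have "bounded (\<phi> ` {0..1})"
      by (intro compact_imp_bounded compact_continuous_image \<phi>) simp
    then obtain B where "\<And>x. x \<in> {0..1} \<Longrightarrow> norm (\<phi> x) \<le> B"
      unfolding bounded_iff by blast
    then have int: "integrable (\<mu> \<Otimes>\<^sub>M ?B) (\<lambda>z. \<phi> (?g z))"
      using p by (intro P.integrable_const_bound[where B = B] AE_I2 measurable_compose[OF g \<phi>m])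
         (auto simp: space_pair_measure probs_space[OF \<mu>])
    have "(\<integral>x. \<phi> x \<partial>distr (\<mu> \<Otimes>\<^sub>M ?B) borel01 ?g) = (\<integral>z. \<phi> (?g z) \<partial>(\<mu> \<Otimes>\<^sub>M ?B))"
      by (rule integral_distr[OF g \<phi>m])
    also have "\<dots> = (\<integral>x. (\<integral>b. \<phi> (?g (x, b)) \<partial>?B) \<partial>\<mu>)"
      by (rule P.integral_fst'[OF int, symmetric])
    also have "\<dots> = (\<integral>x. t * \<phi> p + (1 - t) * \<phi> x \<partial>\<mu>)"
      using t by (simp add: mult.commute)
    also have "\<dots> = (1 - t) * (\<integral>x. \<phi> x \<partial>\<mu>) + t * \<phi> p"
      using continuous_integrable_probs[OF \<mu> \<phi>] by (simp add: M.prob_space)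
    finally show "(\<integral>x. \<phi> x \<partial>distr (\<mu> \<Otimes>\<^sub>M ?B) borel01 ?g) = (1 - t) * (\<integral>x. \<phi> x \<partial>\<mu>) + t * \<phi> p" .
  qed
qed

text \<open>A small mass placed at whichever of \<open>p\<close>, \<open>q\<close> has the value of \<open>\<phi>\<close> opposite to \<open>\<integral>\<phi> d\<mu>\<close> pushes the
  integral strictly between \<open>0\<close> and \<open>1\<close>, while the measure remains invariant and stays close to \<open>\<mu>\<close>.\<close>

lemma pseudo_physical_no_interior:
  fixes \<phi> :: "real \<Rightarrow> real"
  assumes f: "f \<in> mspace selfmaps"
    and \<phi>: "continuous_on {0..1} \<phi>"
    and dich: "\<And>\<mu>. \<mu> \<in> pseudo_physical \<Psi> f \<Longrightarrow> (\<integral>y. \<phi> y \<partial>\<mu>) \<in> {0, 1}"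
    and p: "p \<in> {0..1}" "f p = p" "\<phi> p = 1" and q: "q \<in> {0..1}" "f q = q" "\<phi> q = 0"
  shows "invariant_space f interior_of (pseudo_physical \<Psi> f) = {}"
proof (rule ccontr)
  assume "\<not> ?thesis"
  then obtain \<mu> T where T: "openin (invariant_space f) T" "\<mu> \<in> T" "T \<subseteq> pseudo_physical \<Psi> f"
    by (auto simp: interior_of_def)
  then obtain V where V: "openin weak_star V" "T = V \<inter> invariant_probs f"
    unfolding invariant_space_def openin_subtopology by blast
  have \<mu>: "\<mu> \<in> probs" "\<mu> \<in> invariant_probs f" "\<mu> \<in> V"
    using T V by (auto simp: invariant_probs_def)
  define a where "a = (\<integral>y. \<phi> y \<partial>\<mu>)"
  have a: "a \<in> {0, 1}" unfolding a_def using dich T by blast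
  obtain y where y: "y \<in> {0..1}" "f y = y" "\<phi> y = 1 - a"
    using a p q by auto
  define t :: "nat \<Rightarrow> real" where "t n = 1 / real (Suc (Suc n))" for n
  have t: "0 < t n" "t n < 1" for n by (auto simp: t_def)
  have "\<forall>n. \<exists>\<rho>. \<rho> \<in> probs \<and> (\<forall>\<phi> :: real \<Rightarrow> real. continuous_on {0..1} \<phi> \<longrightarrow>
       (\<integral>x. \<phi> x \<partial>\<rho>) = (1 - t n) * (\<integral>x. \<phi> x \<partial>\<mu>) + t n * \<phi> y)"
    using mix_point_mass[OF \<mu>(1) y(1) less_imp_le[OF t(1)] less_imp_le[OF t(2)]] by metis
  then obtain \<rho> where \<rho>: "\<And>n. \<rho> n \<in> probs" and int: "\<And>n \<phi>. continuous_on {0..1} \<phi> \<Longrightarrow>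
       (\<integral>x. \<phi> x \<partial>\<rho> n) = (1 - t n) * (\<integral>x. \<phi> x \<partial>\<mu>) + t n * \<phi> y"
    by metis
  have "t \<longlonglongrightarrow> 0"
    unfolding t_def by (rule LIMSEQ_Suc[OF LIMSEQ_Suc[OF lim_1_over_n]])
  then have "(\<lambda>n. (1 - t n) * c + t n * d) \<longlonglongrightarrow> (1 - 0) * c + 0 * d" for c d
    by (intro tendsto_intros)
  then have "limitin weak_star \<rho> \<mu> sequentially"
    using \<rho> \<mu> by (simp add: limitin_weak_star_iff int)
  then have "\<forall>\<^sub>F n in sequentially. \<rho> n \<in> V"
    using V \<mu> by (auto simp: limitin_def)
  then obtain n where n: "\<rho> n \<in> V" using eventually_happens by force
  have "\<rho> n \<in> invariant_probs f"
  proof (rule invariant_probsI[OF \<rho> f])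
    fix \<psi> :: "real \<Rightarrow> real"
    assume \<psi>: "continuous_on {0..1} \<psi>"
    have "continuous_on {0..1} (\<lambda>x. \<psi> (f x))"
      by (rule continuous_on_compose2[OF \<psi>]) (use f in \<open>auto simp: mspace_selfmaps\<close>)
    then show "(\<integral>x. \<psi> (f x) \<partial>\<rho> n) = (\<integral>x. \<psi> x \<partial>\<rho> n)"
      using \<psi> invariant_integral[OF \<mu>(2) f \<psi>] y(2) by (simp add: int)
  qed
  then have "(\<integral>y. \<phi> y \<partial>\<rho> n) \<in> {0, 1}" using dich n T V by blast
  then show False
    using a t[of n] unfolding int[OF \<phi>] y(3) a_def[symmetric] by auto
qed

section \<open>Trapping intervals\<close>

definition trapping :: "(real \<Rightarrow> real) \<Rightarrow> real \<Rightarrow> real \<Rightarrow> bool" where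
  "trapping f m r \<longleftrightarrow> 0 < r \<and> cball m r \<subseteq> {0..1} \<and> f ` cball m r \<subseteq> ball m r"

definition two_traps :: "(real \<Rightarrow> real) \<Rightarrow> bool" where
  "two_traps f \<longleftrightarrow> (\<exists>m m' r. trapping f m r \<and> trapping f m' r \<and> disjnt (cball m r) (cball m' r))"

text \<open>By compactness the image of the trap keeps a positive distance from its boundary. This leaves
  room for the test function to descend from \<open>1\<close> to \<open>0\<close>, and for perturbing the map.\<close>

lemma trapping_margin:
  assumes f: "f \<in> mspace selfmaps" and trap: "trapping f m r"
  obtains s where "s < r" "f ` cball m r \<subseteq> cball m s"
proof -
  have "continuous_on (cball m r) f"
    using f trap by (auto simp: mspace_selfmaps trapping_def intro: continuous_on_subset)
  then have "continuous_on (cball m r) (\<lambda>x. dist m (f x))"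
    by (intro continuous_intros)
  then obtain x where x: "x \<in> cball m r" "\<And>y. y \<in> cball m r \<Longrightarrow> dist m (f y) \<le> dist m (f x)"
    using continuous_attains_sup[of "cball m r" "\<lambda>x. dist m (f x)"] trap
    by (auto simp: trapping_def)
  have "f x \<in> ball m r" using x(1) trap unfolding trapping_def by blast
  then have "dist m (f x) < r" by simp
  moreover have "f ` cball m r \<subseteq> cball m (dist m (f x))" using x(2) by auto
  ultimately show thesis by (rule that)
qed

lemma trapping_fixed_point:
  assumes f: "f \<in> mspace selfmaps" and trap: "trapping f m r"
  obtains p where "p \<in> cball m r" "f p = p"
proof (rule brouwer[of "cball m r" f])
  show "continuous_on (cball m r) f"
    using f trap by (auto simp: mspace_selfmaps trapping_def intro: continuous_on_subset)
  show "f \<in> cball m r \<rightarrow> cball m r" using trap by (auto simp: trapping_def intro: less_imp_le)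
qed (use trap that in \<open>auto simp: trapping_def\<close>)

lemma cesaro_eventually_const:
  fixes a :: "nat \<Rightarrow> real"
  assumes "\<And>j. N \<le> j \<Longrightarrow> a j = c"
  shows "(\<lambda>n. (\<Sum>j<n. a j) / n) \<longlonglongrightarrow> c"
proof -
  define K where "K = (\<Sum>j<N. a j) - N * c"
  have "(\<Sum>j<n. a j) / n = K / n + c" if n: "N \<le> n" "0 < n" for n
  proof -
    have "(\<Sum>j<n. a j) = (\<Sum>j<N. a j) + (\<Sum>j\<in>{N..<n}. a j)"
      using n by (subst sum.union_disjoint[symmetric]) (auto simp: ivl_disj_un)
    also have "(\<Sum>j\<in>{N..<n}. a j) = (real n - N) * c"
      using assms n by (simp add: of_nat_diff)
    finally show ?thesis using n by (simp add: K_def field_simps)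
  qed
  then have "\<forall>\<^sub>F n in sequentially. K / n + c = (\<Sum>j<n. a j) / n"
    using eventually_conj[OF eventually_ge_at_top[of N] eventually_gt_at_top[of 0]]
    by (auto elim: eventually_mono)
  moreover have "(\<lambda>n. K / real n + c) \<longlonglongrightarrow> 0 + c"
    by (intro tendsto_intros lim_const_over_n)
  ultimately show ?thesis using Lim_transform_eventually by force
qed

text \<open>An orbit that enters the trap never leaves it and is eventually in the set \<open>\<phi> = 1\<close>; an orbit
  that never enters stays in the set \<open>\<phi> = 0\<close>.\<close>

lemma trapped_limit_integral:
  fixes \<phi> :: "real \<Rightarrow> real"
  assumes f: "f \<in> mspace selfmaps" and trap: "trapping f m r" and s: "f ` cball m r \<subseteq> cball m s"
    and \<phi>: "continuous_on {0..1} \<phi>" "\<And>x. x \<in> cball m s \<Longrightarrow> \<phi> x = 1" "\<And>x. x \<notin> cball m r \<Longrightarrow> \<phi> x = 0"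
    and x: "x \<in> {0..1}" and \<nu>: "\<nu> \<in> p\<omega> f x"
  shows "(\<integral>y. \<phi> y \<partial>\<nu>) \<in> {0, 1}"
proof (cases "\<exists>N. (f ^^ N) x \<in> cball m r")
  case True
  then obtain N where N: "(f ^^ N) x \<in> cball m r" by blast
  have stay: "(f ^^ j) x \<in> cball m r" if "N \<le> j" for j
    using that
  proof (induction j rule: dec_induct)
    case (step j)
    then have "f ((f ^^ j) x) \<in> ball m r" using trap unfolding trapping_def by blast
    then show ?case by simp
  qed (rule N)
  have "\<phi> ((f ^^ j) x) = 1" if "Suc N \<le> j" for j
  proof -
    obtain i where i: "j = Suc i" "N \<le> i" using \<open>Suc N \<le> j\<close> by (cases j) auto
    show ?thesis using stay[OF i(2)] s i(1) by (auto intro!: \<phi>(2))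
  qed
  then show ?thesis
    using p\<omega>_integral[OF f x \<nu> \<phi>(1) cesaro_eventually_const] by blast
next
  case False
  then show ?thesis
    using p\<omega>_integral[OF f x \<nu> \<phi>(1) cesaro_eventually_const[of 0 _ 0]] \<phi>(3) by simp
qed

lemma two_traps_no_interior:
  assumes dense: "dense_in (mtopology_of selfmaps) (range \<Psi>)"
    and f: "f \<in> mspace selfmaps" and traps: "two_traps f"
  shows "invariant_space f interior_of (pseudo_physical \<Psi> f) = {}"
proof -
  obtain m m' r where m: "trapping f m r" and m': "trapping f m' r"
    and disj: "disjnt (cball m r) (cball m' r)"
    using traps by (auto simp: two_traps_def)
  obtain s where s: "s < r" "f ` cball m r \<subseteq> cball m s" by (rule trapping_margin[OF f m])
  obtain p where p: "p \<in> cball m r" "f p = p" by (rule trapping_fixed_point[OF f m])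
  obtain q where q: "q \<in> cball m' r" "f q = q" by (rule trapping_fixed_point[OF f m'])
  \<comment> \<open>\<open>p\<close> is the image of a point of the trap, namely of itself.\<close>
  have ps: "p \<in> cball m s" using p s(2) by force
  have qr: "q \<notin> cball m r" using q disj by (auto simp: disjnt_iff)
  define \<phi> :: "real \<Rightarrow> real" where "\<phi> x = max 0 (min 1 ((r - dist m x) / (r - s)))" for x
  have \<phi>: "continuous_on {0..1} \<phi>" "\<phi> \<in> {0..1} \<rightarrow> {0..1}"
    "\<And>x. x \<in> cball m s \<Longrightarrow> \<phi> x = 1" "\<And>x. x \<notin> cball m r \<Longrightarrow> \<phi> x = 0"
  proof -
    show "continuous_on {0..1} \<phi>"
      unfolding \<phi>_def using s(1) by (intro continuous_intros) auto
    show "\<phi> \<in> {0..1} \<rightarrow> {0..1}" by (simp add: \<phi>_def)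
    show "\<phi> x = 1" if "x \<in> cball m s" for x
    proof -
      have "1 \<le> (r - dist m x) / (r - s)" using that s(1) by (simp add: pos_le_divide_eq)
      then show ?thesis by (simp add: \<phi>_def)
    qed
    show "\<phi> x = 0" if "x \<notin> cball m r" for x
    proof -
      have "(r - dist m x) / (r - s) \<le> 0" using that s(1) by (simp add: divide_nonpos_pos)
      then show ?thesis by (simp add: \<phi>_def)
    qed
  qed
  show ?thesis
  proof (rule pseudo_physical_no_interior[OF f \<phi>(1)])
    show "(\<integral>y. \<phi> y \<partial>\<mu>) \<in> {0, 1}" if "\<mu> \<in> pseudo_physical \<Psi> f" for \<mu>
    proof (rule pseudo_physical_integral_closed[OF dense f \<phi>(1,2) _ _ that])
      show "(\<integral>y. \<phi> y \<partial>\<nu>) \<in> {0, 1}" if "x \<in> {0..1}" "\<nu> \<in> p\<omega> f x" for x \<nu>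
        by (rule trapped_limit_integral[OF f m s(2) \<phi>(1) \<phi>(3) \<phi>(4) that])
    qed simp
    show "p \<in> {0..1}" "q \<in> {0..1}" using p q m m' by (auto simp: trapping_def)
    show "f p = p" "f q = q" "\<phi> p = 1" "\<phi> q = 0"
      using p q \<phi>(3)[OF ps] \<phi>(4)[OF qr] by auto
  qed
qed

section \<open>Two disjoint traps are typical\<close>

lemma trapping_stable:
  assumes f: "f \<in> mspace selfmaps" and trap: "trapping f m r"
  obtains \<delta> where "0 < \<delta>" "\<And>g. g \<in> mspace selfmaps \<Longrightarrow> mdist selfmaps f g < \<delta> \<Longrightarrow> trapping g m r"
proof -
  obtain s where s: "s < r" "f ` cball m r \<subseteq> cball m s" by (rule trapping_margin[OF f trap])
  show thesis
  proof (rule that[of "r - s"])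
    fix g assume g: "g \<in> mspace selfmaps" "mdist selfmaps f g < r - s"
    have "dist m (g x) < r" if x: "x \<in> cball m r" for x
    proof -
      have "x \<in> {0..1}" using trap x unfolding trapping_def by blast
      then have "\<bar>f x - g x\<bar> < r - s"
        using le_less_trans[OF selfmaps_diff_le_mdist[OF f g(1)] g(2)] by blast
      moreover have "f x \<in> cball m s" using s(2) x by blast
      ultimately show ?thesis by (simp add: dist_real_def)
    qed
    with trap show "trapping g m r" by (auto simp: trapping_def)
  qed (use s in simp)
qed

lemma two_traps_openin: "openin (mtopology_of selfmaps) {f \<in> mspace selfmaps. two_traps f}"
proof -
  interpret S: Metric_space "mspace selfmaps" "mdist selfmaps"
    by (rule Metric_space_mspace_mdist)
  have "\<exists>\<delta>>0. S.mball f \<delta> \<subseteq> {f \<in> mspace selfmaps. two_traps f}"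
    if f: "f \<in> mspace selfmaps" and traps: "two_traps f" for f
  proof -
    obtain m m' r where m: "trapping f m r" and m': "trapping f m' r"
      and disj: "disjnt (cball m r) (cball m' r)"
      using traps by (auto simp: two_traps_def)
    obtain \<delta> where \<delta>: "0 < \<delta>" "\<And>g. g \<in> mspace selfmaps \<Longrightarrow> mdist selfmaps f g < \<delta> \<Longrightarrow> trapping g m r"
      using trapping_stable[OF f m] by blast
    obtain \<delta>' where \<delta>': "0 < \<delta>'" "\<And>g. g \<in> mspace selfmaps \<Longrightarrow> mdist selfmaps f g < \<delta>' \<Longrightarrow> trapping g m' r"
      using trapping_stable[OF f m'] by blast
    have "two_traps g" if "g \<in> S.mball f (min \<delta> \<delta>')" for g
      using that \<delta>(2)[of g] \<delta>'(2)[of g] disj unfolding two_traps_def by auto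
    then show ?thesis using \<delta>(1) \<delta>'(1)
      by (intro exI[of _ "min \<delta> \<delta>'"]) auto
  qed
  then show ?thesis unfolding mtopology_of_def S.openin_mtopology by auto
qed

text \<open>A convex combination of \<open>f x\<close> and \<open>m\<close>, whose weight drops from \<open>1\<close> at distance \<open>r\<close> of \<open>m\<close> to \<open>0\<close> at
  distance \<open>2 * r\<close>.\<close>

definition tilt :: "(real \<Rightarrow> real) \<Rightarrow> real \<Rightarrow> real \<Rightarrow> real \<Rightarrow> real" where
  "tilt f m r x = f x + max 0 (min 1 (2 - \<bar>x - m\<bar> / r)) * (m - f x)"

lemma tilt_continuous: "0 < r \<Longrightarrow> continuous_on S f \<Longrightarrow> continuous_on S (tilt f m r)"
  unfolding tilt_def by (intro continuous_intros) auto

lemma tilt_near: "0 < r \<Longrightarrow> \<bar>x - m\<bar> \<le> r \<Longrightarrow> tilt f m r x = m"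
  by (simp add: tilt_def field_simps min_def max_def)

lemma tilt_far: "0 < r \<Longrightarrow> 2 * r \<le> \<bar>x - m\<bar> \<Longrightarrow> tilt f m r x = f x"
  by (simp add: tilt_def field_simps min_def max_def)

lemma tilt_between: "tilt f m r x \<in> closed_segment (f x) m"
  unfolding closed_segment_def mem_Collect_eq
proof (intro exI conjI)
  show "tilt f m r x = (1 - max 0 (min 1 (2 - \<bar>x - m\<bar> / r))) *\<^sub>R f x +
      max 0 (min 1 (2 - \<bar>x - m\<bar> / r)) *\<^sub>R m"
    unfolding tilt_def real_scaleR_def by algebra
qed simp_all

lemma tilt_in_01: "f x \<in> {0..1} \<Longrightarrow> m \<in> {0..1} \<Longrightarrow> tilt f m r x \<in> {0..1}"
  using tilt_between[of f m r x] closed_segment_subset[of "f x" "{0..1}" m] by auto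

lemma tilt_close: "\<bar>tilt f m r x - f x\<bar> \<le> \<bar>m - f x\<bar>"
  using tilt_between[of f m r x] by (auto simp: closed_segment_eq_real_ivl split: if_splits)

text \<open>Near a fixed point \<open>c\<close> the values of \<open>f\<close> are close to \<open>c\<close>, so they can be tilted to any
  nearby constants.\<close>

lemma two_traps_approx:
  assumes f: "f \<in> mspace selfmaps" and \<epsilon>: "0 < \<epsilon>"
  obtains g where "g \<in> mspace selfmaps" "two_traps g" "mdist selfmaps f g < \<epsilon>"
proof -
  have f': "continuous_on {0..1} f" "f \<in> {0..1} \<rightarrow> {0..1}" "f \<in> extensional {0..1}"
    using f by (auto simp: mspace_selfmaps)
  obtain c where c: "c \<in> {0..1}" "f c = c"
    using brouwer[of "{0..1::real}" f] f' by auto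
  obtain \<delta> where \<delta>: "0 < \<delta>" "\<And>x. x \<in> {0..1} \<Longrightarrow> dist x c < \<delta> \<Longrightarrow> dist (f x) (f c) < \<epsilon> / 4"
    using f'(1)[unfolded continuous_on_iff] c \<epsilon> by (metis divide_pos_pos zero_less_numeral)
  define d where "d = min \<delta> (min (\<epsilon> / 4) (1 / 2))"
  have d: "0 < d" "d \<le> \<delta>" "d \<le> \<epsilon> / 4" "d \<le> 1 / 2" using \<delta> \<epsilon> by (auto simp: d_def)
  \<comment> \<open>The centres lie on the side of \<open>c\<close> that leaves room in the unit interval.\<close>
  define a where "a = (if c \<le> 1 / 2 then c else c - d / 2)"
  have a: "0 \<le> a" "a + d / 2 \<le> 1" "c - d / 2 \<le> a" "a \<le> c"
    using c d by (auto simp: a_def)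
  \<comment> \<open>The intervals of radius \<open>2 * r\<close> around the centres are disjoint and lie in \<open>{a..a + d / 2}\<close>.\<close>
  define r where "r = d / 32"
  define m where "m = a + d / 8"
  define m' where "m' = a + 3 * d / 8"
  have r: "0 < r" using d by (simp add: r_def)
  define g where "g = restrict (tilt (tilt f m r) m' r) {0..1}"
  have mm: "m \<in> {0..1}" "m' \<in> {0..1}" using a d by (auto simp: m_def m'_def)
  have gM: "g \<in> mspace selfmaps"
  proof -
    have "continuous_on {0..1} g"
      by (rule continuous_on_eq[OF tilt_continuous[OF r tilt_continuous[OF r f'(1)]]]) (simp add: g_def)
    moreover have "g \<in> {0..1} \<rightarrow> {0..1}"
    proof
      fix x :: real assume x: "x \<in> {0..1}"
      then have "f x \<in> {0..1}" using f'(2) by blast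
      then show "g x \<in> {0..1}" using x tilt_in_01 mm by (simp add: g_def del: atLeastAtMost_iff)
    qed
    ultimately show ?thesis by (simp add: mspace_selfmaps g_def)
  qed
  have sep: "2 * r \<le> \<bar>x - m'\<bar>" if "\<bar>x - m\<bar> \<le> 2 * r" for x
    using that d unfolding r_def m_def m'_def by linarith
  have "two_traps g"
    unfolding two_traps_def
  proof (intro exI conjI)
    have in01: "cball m r \<subseteq> {0..1}" "cball m' r \<subseteq> {0..1}"
      using a d by (simp_all add: cball_eq_atLeastAtMost r_def m_def m'_def)
    have "g x = m" if "x \<in> cball m r" for x
      using that in01 r sep[of x] tilt_near[OF r, of x m] tilt_far[OF r, of x m']
      by (auto simp: g_def dist_real_def abs_minus_commute)
    then show "trapping g m r" using in01 r by (auto simp: trapping_def)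
    have "g x = m'" if "x \<in> cball m' r" for x
      using that in01 r tilt_near[OF r, of x m']
      by (auto simp: g_def dist_real_def abs_minus_commute)
    then show "trapping g m' r" using in01 r by (auto simp: trapping_def)
    show "disjnt (cball m r) (cball m' r)"
      unfolding disjnt_iff
    proof (intro allI notI)
      fix x assume "x \<in> cball m r \<and> x \<in> cball m' r"
      then have "\<bar>x - m\<bar> \<le> r" "\<bar>x - m'\<bar> \<le> r" by (auto simp: dist_real_def)
      then show False using sep[of x] r by linarith
    qed
  qed
  moreover have "\<bar>f x - g x\<bar> \<le> \<epsilon> / 2" if x: "x \<in> {0..1}" for x
  proof -
    have close: "\<bar>n - f x\<bar> \<le> \<epsilon> / 2" if "\<bar>x - n\<bar> \<le> 2 * r" "n = m \<or> n = m'" for n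
    proof -
      have "n = a + d / 8 \<or> n = a + 3 * d / 8" "\<bar>x - n\<bar> \<le> d / 16"
        using that by (simp_all add: r_def m_def m'_def)
      then have "\<bar>x - c\<bar> < d" "\<bar>n - c\<bar> \<le> d" using a d by linarith+
      moreover from this have "\<bar>f x - c\<bar> < \<epsilon> / 4"
        using \<delta>(2)[OF x] d c(2) by (simp add: dist_real_def)
      ultimately show ?thesis using d(3) by linarith
    qed
    consider "\<bar>x - m\<bar> \<le> 2 * r" | "\<bar>x - m'\<bar> \<le> 2 * r" "2 * r \<le> \<bar>x - m\<bar>" | "2 * r \<le> \<bar>x - m\<bar>" "2 * r \<le> \<bar>x - m'\<bar>"
      by linarith
    then show ?thesis
    proof cases
      case 1
      then have "g x = tilt f m r x" using tilt_far[OF r sep[OF 1]] x by (simp add: g_def)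
      then show ?thesis using tilt_close[of f m r x] close[OF 1] by linarith
    next
      case 2
      then have "\<bar>g x - f x\<bar> \<le> \<bar>m' - f x\<bar>"
        using tilt_close[of "tilt f m r" m' r x] tilt_far[OF r 2(2)] x by (simp add: g_def)
      then show ?thesis using close[OF 2(1)] by linarith
    next
      case 3
      then show ?thesis using tilt_far[OF r] x \<epsilon> by (simp add: g_def)
    qed
  qed
  then have "mdist selfmaps f g \<le> \<epsilon> / 2"
    unfolding mdist_selfmaps[OF f gM] by (intro cSUP_least) auto
  ultimately show thesis using gM \<epsilon> by (intro that[of g]) auto
qed

lemma two_traps_dense: "dense_in (mtopology_of selfmaps) {f \<in> mspace selfmaps. two_traps f}"
proof -
  interpret S: Metric_space "mspace selfmaps" "mdist selfmaps"
    by (rule Metric_space_mspace_mdist)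
  have "\<exists>g\<in>{f \<in> mspace selfmaps. two_traps f}. g \<in> S.mball f \<epsilon>"
    if "f \<in> mspace selfmaps" "0 < \<epsilon>" for f \<epsilon>
    using two_traps_approx[OF that] that by (metis (mono_tags, lifting) S.in_mball mem_Collect_eq)
  then show ?thesis
    unfolding dense_in_def mtopology_of_def S.metric_closure_of by auto
qed

theorem theorem16:
  fixes \<Psi> :: "nat \<Rightarrow> real \<Rightarrow> real"
  assumes "dense_in (mtopology_of selfmaps) (range \<Psi>)"
  shows "holds_for_typical_map (\<lambda>f. less_than_meager (invariant_space f) (pseudo_physical \<Psi> f))"
  unfolding holds_for_typical_map_def
proof (intro exI conjI ballI)
  show "gdelta_in (mtopology_of selfmaps) {f \<in> mspace selfmaps. two_traps f}"
    by (rule open_imp_gdelta_in[OF two_traps_openin])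
  show "dense_in (mtopology_of selfmaps) {f \<in> mspace selfmaps. two_traps f}"
    by (rule two_traps_dense)
  fix f assume "f \<in> {f \<in> mspace selfmaps. two_traps f}"
  then have f: "f \<in> mspace selfmaps" and traps: "two_traps f" by auto
  have "closedin (invariant_space f) (pseudo_physical \<Psi> f)"
    unfolding invariant_space_def
    by (intro closedin_subset_topspace pseudo_physical_closedin f
        dense_test_functions pseudo_physical_invariant assms)
  with two_traps_no_interior[OF assms f traps]
  show "less_than_meager (invariant_space f) (pseudo_physical \<Psi> f)"
    by (simp add: less_than_meager_def)
qed

end
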